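(* Let $(\mathscr{O},\eta,e)$ be an operad. Then $(\mathscr{O}',\mathscr{O})$ with product $(\rho,\eta)$, where $\rho=\eta'$, and identity $(\mathfrak{e},e)$, where $\mathfrak{e}=e'$, is a monop.
   Context: Species, product $\cdot$, substitution $R(P)$ (for $P$ positive), species $1$ and $X$, operads $(\mathscr O,\eta:\mathscr O(\mathscr O)\to\mathscr O, e:X\to\mathscr O)$ are as usual in the theory of combinatorial species: $(M\cdot N)[V]=\sum_{V_1+V_2=V}M[V_1]\times N[V_2]$; $R(P)[V]=\sum_{\pi}(\prod_{B\in\pi}P[B])\times R[\pi]$ over partitions $\pi$ of $V$; $1[\emptyset]=\{\emptyset\}$, $1[V]=\emptyset$ for $V\neq\emptyset$; $X[V]=V$ if $|V|=1$, else $\emptyset$; an operad is a monoid for substitution on positive species (associative product $\eta$ with two-sided unit $e$). The derivative of a species $F$ is $F'[V]=F[V+\{\ast\}]$ ($\ast$ a new point), and of a morphism $\phi$ is $\phi'_V=\phi_{V+\{\ast\}}$. By the chain rule $(\mathscr{O}(\mathscr{O}))'\cong\mathscr{O}'(\mathscr{O})\cdot\mathscr{O}'\cong\mathscr{O}'\cdot\mathscr{O}'(\mathscr{O})$ and $X'\cong 1$, so $\eta'$ is regarded as a morphism $\mathscr{O}'\cdot\mathscr{O}'(\mathscr{O})\to\mathscr{O}'$ and $e'$ as a morphism $1\to\mathscr{O}'$. Riordan category: objects are pairs $(M,\mathscr{O})$ of species with $\mathscr{O}$ positive; monoidal product $(M_1,\mathscr{O}_1)\ast(M_2,\mathscr{O}_2)=(M_1\cdot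 M_2(\mathscr{O}_1),\mathscr{O}_2(\mathscr{O}_1))$, on morphisms $(\phi_1,\psi_1)\ast(\phi_2,\psi_2)=(\phi_1\cdot\phi_2(\psi_1),\psi_2(\psi_1))$, unit $(1,X)$; associativity isomorphism: associativity of substitution in the second component, and in the first component associativity of product composed with the canonical isomorphisms $(A\cdot B)(C)\cong A(C)\cdot B(C)$, $A(B)(C)\cong A(B(C))$. A monop is a monoid in this category, i.e. a pair $(M,\mathscr{O})$ with $(\rho,\eta):(M,\mathscr{O})\ast(M,\mathscr{O})\to(M,\mathscr{O})$ and $(\mathfrak{e},e):(1,X)\to(M,\mathscr{O})$ satisfying the monoid associativity and unit axioms. *)

theory Defs
  imports "HOL-Library.FSet" "HOL-Library.FuncSet" "HOL-Library.Disjoint_Sets"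
begin

text \<open>Labels form a universe over arbitrary atoms in which every finite set of labels is again a
  label. So a species can be evaluated on the set of blocks of a partition, and every finite set
  \<open>V\<close> of labels comes with a label outside \<open>V\<close>.\<close>

datatype 'a label = Atom 'a | Block "'a label fset"

definition blk :: "'a label set \<Rightarrow> 'a label" where
  "blk B = Block (Abs_fset B)"

primrec unblk :: "'a label \<Rightarrow> 'a label set" where
  "unblk (Atom a) = {}"
| "unblk (Block b) = fset b"

lemma unblk_blk [simp]: "finite B \<Longrightarrow> unblk (blk B) = B"
  by (simp add: blk_def Abs_fset_inverse)

text \<open>The new point of \<open>V + {*}\<close> is the set \<open>V\<close> itself.\<close>

definition star :: "'a label set \<Rightarrow> 'a label" where
  "star V = blk V"

definition plus_star :: "'a label set \<Rightarrow> 'a label set" where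
  "plus_star V = insert (star V) V"

lemma star_notin:
  assumes "finite V"
  shows "star V \<notin> V"
proof
  assume a: "star V \<in> V"
  have "x \<notin> unblk x" for x :: "'a label"
  proof (induction x)
    case (Block b)
    from Block[of "Block b"] show ?case by auto
  qed simp
  from this[of "star V"] a assms show False
    by (simp add: star_def)
qed


subsection \<open>Species and their morphisms\<close>

text \<open>\<open>tr F U \<sigma>\<close> is the transport \<open>F[\<sigma>]\<close> along the bijection from \<open>U\<close> onto \<open>\<sigma> ` U\<close>
  given by a function \<open>\<sigma>\<close> that is injective on \<open>U\<close>.\<close>

record ('a, 's) species =
  str :: "'a label set \<Rightarrow> 's set"
  tr :: "'a label set \<Rightarrow> ('a label \<Rightarrow> 'a label) \<Rightarrow> 's \<Rightarrow> 's"

definition is_species :: "('a, 's) species \<Rightarrow> bool" where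
  "is_species F \<longleftrightarrow>
     (\<forall>U. finite U \<longrightarrow> finite (str F U)) \<and>
     (\<forall>U \<sigma>. finite U \<longrightarrow> inj_on \<sigma> U \<longrightarrow> (\<forall>s\<in>str F U. tr F U \<sigma> s \<in> str F (\<sigma> ` U))) \<and>
     (\<forall>U \<sigma> \<tau>. finite U \<longrightarrow> inj_on \<sigma> U \<longrightarrow> (\<forall>x\<in>U. \<sigma> x = \<tau> x) \<longrightarrow>
        (\<forall>s\<in>str F U. tr F U \<sigma> s = tr F U \<tau> s)) \<and>
     (\<forall>U. finite U \<longrightarrow> (\<forall>s\<in>str F U. tr F U id s = s)) \<and>
     (\<forall>U \<sigma> \<tau>. finite U \<longrightarrow> inj_on \<sigma> U \<longrightarrow> inj_on \<tau> (\<sigma> ` U) \<longrightarrow>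
        (\<forall>s\<in>str F U. tr F U (\<tau> \<circ> \<sigma>) s = tr F (\<sigma> ` U) \<tau> (tr F U \<sigma> s)))"

definition positive :: "('a, 's) species \<Rightarrow> bool" where
  "positive F \<longleftrightarrow> str F {} = {}"

type_synonym ('a, 's, 't) mor = "'a label set \<Rightarrow> 's \<Rightarrow> 't"

definition is_mor :: "('a, 's) species \<Rightarrow> ('a, 't) species \<Rightarrow> ('a, 's, 't) mor \<Rightarrow> bool" where
  "is_mor F G \<phi> \<longleftrightarrow>
     (\<forall>U. finite U \<longrightarrow> (\<forall>s\<in>str F U. \<phi> U s \<in> str G U)) \<and>
     (\<forall>U \<sigma>. finite U \<longrightarrow> inj_on \<sigma> U \<longrightarrow>
        (\<forall>s\<in>str F U. \<phi> (\<sigma> ` U) (tr F U \<sigma> s) = tr G U \<sigma> (\<phi> U s)))"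

text \<open>Equality of morphisms with domain \<open>F\<close>.\<close>

definition mor_eq :: "('a, 's) species \<Rightarrow> ('a, 's, 't) mor \<Rightarrow> ('a, 's, 't) mor \<Rightarrow> bool" where
  "mor_eq F \<phi> \<psi> \<longleftrightarrow> (\<forall>U. finite U \<longrightarrow> (\<forall>s\<in>str F U. \<phi> U s = \<psi> U s))"

definition mor_id :: "('a, 's, 's) mor" where
  "mor_id U s = s"

definition mor_comp :: "('a, 't, 'u) mor \<Rightarrow> ('a, 's, 't) mor \<Rightarrow> ('a, 's, 'u) mor"
    (infixl "\<circ>\<^sub>s" 65) where
  "(\<phi> \<circ>\<^sub>s \<psi>) U s = \<phi> U (\<psi> U s)"


subsection \<open>The species \<open>1\<close> and \<open>X\<close>, product, substitution, derivative\<close>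

definition sp_one :: "('a, 'a label set) species" where
  "sp_one = \<lparr>str = \<lambda>V. if V = {} then {{}} else {}, tr = \<lambda>V \<sigma> s. s\<rparr>"

definition sp_X :: "('a, 'a label) species" where
  "sp_X = \<lparr>str = \<lambda>V. if card V = 1 then V else {}, tr = \<lambda>V \<sigma> x. \<sigma> x\<rparr>"

type_synonym ('a, 's, 't) prod_str = "('a label set \<times> 'a label set) \<times> ('s \<times> 't)"

definition sp_prod ::
    "('a, 's) species \<Rightarrow> ('a, 't) species \<Rightarrow> ('a, ('a, 's, 't) prod_str) species" where
  "sp_prod M N =
     \<lparr>str = \<lambda>V. {((V1, V2), (m, n)) | V1 V2 m n.
              V1 \<union> V2 = V \<and> V1 \<inter> V2 = {} \<and> m \<in> str M V1 \<and> n \<in> str N V2},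
      tr = \<lambda>V \<sigma> ((V1, V2), (m, n)). ((\<sigma> ` V1, \<sigma> ` V2), (tr M V1 \<sigma> m, tr N V2 \<sigma> n))\<rparr>"

definition prod_mor ::
    "('a, 's, 's2) mor \<Rightarrow> ('a, 't, 't2) mor \<Rightarrow> ('a, ('a, 's, 't) prod_str, ('a, 's2, 't2) prod_str) mor"
  where
  "prod_mor \<phi> \<psi> = (\<lambda>V ((V1, V2), (m, n)). ((V1, V2), (\<phi> V1 m, \<psi> V2 n)))"

text \<open>An \<open>R(P)\<close>-structure on \<open>V\<close> is \<open>(\<pi>, f, r)\<close> with \<open>\<pi>\<close> a partition of \<open>V\<close>, \<open>f\<close> a family of
  \<open>P\<close>-structures on its blocks and \<open>r\<close> an \<open>R\<close>-structure on the set of blocks. Families are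
  extensional functions, so that they are determined by their values on \<open>\<pi>\<close>.\<close>

type_synonym ('a, 's, 't) subst_str = "'a label set set \<times> ('a label set \<Rightarrow> 't) \<times> 's"

definition sp_subst ::
    "('a, 's) species \<Rightarrow> ('a, 't) species \<Rightarrow> ('a, ('a, 's, 't) subst_str) species" where
  "sp_subst R P =
     \<lparr>str = \<lambda>V. {(\<pi>, f, r) | \<pi> f r.
              partition_on V \<pi> \<and> f \<in> (\<Pi>\<^sub>E B\<in>\<pi>. str P B) \<and> r \<in> str R (blk ` \<pi>)},
      tr = \<lambda>V \<sigma> (\<pi>, f, r).
              ((`) \<sigma> ` \<pi>,
               \<lambda>C\<in>(`) \<sigma> ` \<pi>. let B = {x \<in> V. \<sigma> x \<in> C} in tr P B \<sigma> (f B),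
               tr R (blk ` \<pi>) (\<lambda>x. blk (\<sigma> ` unblk x)) r)\<rparr>"

definition subst_mor ::
    "('a, 's, 's2) mor \<Rightarrow> ('a, 't, 't2) mor \<Rightarrow> ('a, ('a, 's, 't) subst_str, ('a, 's2, 't2) subst_str) mor"
  where
  "subst_mor \<phi> \<psi> = (\<lambda>V (\<pi>, f, r). (\<pi>, \<lambda>B\<in>\<pi>. \<psi> B (f B), \<phi> (blk ` \<pi>) r))"

definition deriv :: "('a, 's) species \<Rightarrow> ('a, 's) species" where
  "deriv F =
     \<lparr>str = \<lambda>V. str F (plus_star V),
      tr = \<lambda>V \<sigma>. tr F (plus_star V) (\<sigma>(star V := star (\<sigma> ` V)))\<rparr>"

definition deriv_mor :: "('a, 's, 't) mor \<Rightarrow> ('a, 's, 't) mor" where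
  "deriv_mor \<phi> V = \<phi> (plus_star V)"


subsection \<open>Canonical isomorphisms\<close>

text \<open>\<open>A \<cdot> (B \<cdot> C) \<rightarrow> (A \<cdot> B) \<cdot> C\<close>, \<open>M \<cdot> N \<rightarrow> N \<cdot> M\<close>, \<open>1 \<cdot> N \<rightarrow> N\<close> and \<open>N \<cdot> 1 \<rightarrow> N\<close>\<close>

definition prod_assoc ::
    "('a, ('a, 's, ('a, 't, 'u) prod_str) prod_str, ('a, ('a, 's, 't) prod_str, 'u) prod_str) mor" where
  "prod_assoc = (\<lambda>V ((V1, W), (a, ((V2, V3), (b, c)))).
     ((V1 \<union> V2, V3), (((V1, V2), (a, b)), c)))"

definition prod_swap :: "('a, ('a, 's, 't) prod_str, ('a, 't, 's) prod_str) mor" where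
  "prod_swap = (\<lambda>V ((V1, V2), (m, n)). ((V2, V1), (n, m)))"

definition prod_lunit :: "('a, ('a, 'a label set, 's) prod_str, 's) mor" where
  "prod_lunit = (\<lambda>V ((V1, V2), (z, n)). n)"

definition prod_runit :: "('a, ('a, 's, 'a label set) prod_str, 's) mor" where
  "prod_runit = (\<lambda>V ((V1, V2), (n, z)). n)"

text \<open>\<open>(A \<cdot> B)(C) \<rightarrow> A(C) \<cdot> B(C)\<close>: the set of blocks is split into \<open>K1\<close> and \<open>K2\<close>.\<close>

definition subst_distrib ::
    "('a, ('a, ('a, 's, 't) prod_str, 'u) subst_str,
      ('a, ('a, 's, 'u) subst_str, ('a, 't, 'u) subst_str) prod_str) mor" where
  "subst_distrib = (\<lambda>V (\<pi>, f, ((K1, K2), (a, b))).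
     let \<pi>1 = unblk ` K1; \<pi>2 = unblk ` K2
     in ((\<Union>\<pi>1, \<Union>\<pi>2), ((\<pi>1, restrict f \<pi>1, a), (\<pi>2, restrict f \<pi>2, b))))"

text \<open>\<open>A(B)(C) \<rightarrow> A(B(C))\<close>: given a partition \<open>\<pi>\<close> of \<open>V\<close> and a partition \<open>\<kappa>\<close> of its set of blocks,
  each \<open>K \<in> \<kappa>\<close> yields the block \<open>\<Union>K\<close> of a coarser partition of \<open>V\<close>. Such a block \<open>D\<close> is partitioned
  by the blocks of \<open>\<pi>\<close> contained in it, and these make up \<open>K\<close>.\<close>

definition subst_assoc ::
    "('a, 's) species \<Rightarrow>
     ('a, ('a, ('a, 's, 't) subst_str, 'u) subst_str, ('a, 's, ('a, 't, 'u) subst_str) subst_str) mor" where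
  "subst_assoc A = (\<lambda>V (\<pi>, f, (\<kappa>, g, a)).
     let \<pi>' = (\<lambda>K. \<Union>(unblk ` K)) ` \<kappa>
     in (\<pi>',
         \<lambda>D\<in>\<pi>'. let \<pi>D = {B \<in> \<pi>. B \<subseteq> D} in (\<pi>D, restrict f \<pi>D, g (blk ` \<pi>D)),
         tr A (blk ` \<kappa>) (\<lambda>x. blk (\<Union>(unblk ` unblk x))) a))"

text \<open>\<open>X(P) \<rightarrow> P\<close>: there is a single block, \<open>V\<close>.\<close>

definition subst_lunit :: "('a, ('a, 'a label, 's) subst_str, 's) mor" where
  "subst_lunit = (\<lambda>V (\<pi>, f, x). f V)"

text \<open>\<open>A(X) \<rightarrow> A\<close>: the blocks are singletons and the structure on \<open>{v}\<close> is \<open>v\<close>, so \<open>f\<close> identifies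
  the set of blocks with \<open>V\<close>.\<close>

definition subst_runit :: "('a, 's) species \<Rightarrow> ('a, ('a, 's, 'a label) subst_str, 's) mor" where
  "subst_runit A = (\<lambda>V (\<pi>, f, a). tr A (blk ` \<pi>) (\<lambda>x. f (unblk x)) a)"

text \<open>\<open>1(P) \<rightarrow> 1\<close>\<close>

definition subst_one :: "('a, ('a, 'a label set, 's) subst_str, 'a label set) mor" where
  "subst_one = (\<lambda>V (\<pi>, f, z). z)"

text \<open>The chain rule \<open>R'(P) \<cdot> P' \<rightarrow> (R(P))'\<close>: the \<open>P'\<close>-structure on \<open>V1\<close> becomes a \<open>P\<close>-structure on
  the block \<open>B0 = V1 + {*}\<close>, where \<open>*\<close> is now the new point of \<open>V\<close>, and the new point of the set of
  blocks of \<open>\<pi>\<close> becomes \<open>B0\<close>.\<close>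

definition chain_rule ::
    "('a, 's) species \<Rightarrow> ('a, 't) species \<Rightarrow>
     ('a, ('a, ('a, 's, 't) subst_str, 't) prod_str, ('a, 's, 't) subst_str) mor" where
  "chain_rule R P = (\<lambda>V ((V2, V1), ((\<pi>, f, r), p)).
     let B0 = insert (star V) V1
     in (insert B0 \<pi>,
         \<lambda>B\<in>insert B0 \<pi>. if B = B0 then tr P (plus_star V1) (id(star V1 := star V)) p else f B,
         tr R (plus_star (blk ` \<pi>)) (id(star (blk ` \<pi>) := blk B0)) r))"

text \<open>\<open>1 \<rightarrow> X'\<close>\<close>

definition one_deriv_X :: "('a, 'a label set, 'a label) mor" where
  "one_deriv_X = (\<lambda>V z. star V)"


subsection \<open>Operads\<close>

definition operad ::
    "('a, 's) species \<Rightarrow> ('a, ('a, 's, 's) subst_str, 's) mor \<Rightarrow> ('a, 'a label, 's) mor \<Rightarrow> bool" where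
  "operad P \<eta> e \<longleftrightarrow>
     is_species P \<and> positive P \<and>
     is_mor (sp_subst P P) P \<eta> \<and> is_mor sp_X P e \<and>
     mor_eq (sp_subst (sp_subst P P) P)
       (\<eta> \<circ>\<^sub>s subst_mor mor_id \<eta> \<circ>\<^sub>s subst_assoc P)
       (\<eta> \<circ>\<^sub>s subst_mor \<eta> mor_id) \<and>
     mor_eq (sp_subst sp_X P) (\<eta> \<circ>\<^sub>s subst_mor e mor_id) subst_lunit \<and>
     mor_eq (sp_subst P sp_X) (\<eta> \<circ>\<^sub>s subst_mor mor_id e) (subst_runit P)"


subsection \<open>The Riordan category and monops\<close>

type_synonym ('a, 'm, 's) riordan_obj = "('a, 'm) species \<times> ('a, 's) species"

type_synonym ('a, 'm, 's, 'n, 't) riordan_mor = "('a, 'm, 'n) mor \<times> ('a, 's, 't) mor"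

fun is_riordan_obj :: "('a, 'm, 's) riordan_obj \<Rightarrow> bool" where
  "is_riordan_obj (M, P) \<longleftrightarrow> is_species M \<and> is_species P \<and> positive P"

fun is_riordan_mor ::
    "('a, 'm, 's) riordan_obj \<Rightarrow> ('a, 'n, 't) riordan_obj \<Rightarrow> ('a, 'm, 's, 'n, 't) riordan_mor \<Rightarrow> bool" where
  "is_riordan_mor (M, P) (N, Q) (\<phi>, \<psi>) \<longleftrightarrow> is_mor M N \<phi> \<and> is_mor P Q \<psi>"

fun riordan_eq ::
    "('a, 'm, 's) riordan_obj \<Rightarrow> ('a, 'm, 's, 'n, 't) riordan_mor \<Rightarrow> ('a, 'm, 's, 'n, 't) riordan_mor
     \<Rightarrow> bool" where
  "riordan_eq (M, P) (\<phi>1, \<psi>1) (\<phi>2, \<psi>2) \<longleftrightarrow> mor_eq M \<phi>1 \<phi>2 \<and> mor_eq P \<psi>1 \<psi>2"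

definition riordan_id :: "('a, 'm, 's, 'm, 's) riordan_mor" where
  "riordan_id = (mor_id, mor_id)"

fun riordan_comp ::
    "('a, 'n, 't, 'k, 'u) riordan_mor \<Rightarrow> ('a, 'm, 's, 'n, 't) riordan_mor
     \<Rightarrow> ('a, 'm, 's, 'k, 'u) riordan_mor" (infixl "\<circ>\<^sub>R" 65) where
  "(\<phi>2, \<psi>2) \<circ>\<^sub>R (\<phi>1, \<psi>1) = (\<phi>2 \<circ>\<^sub>s \<phi>1, \<psi>2 \<circ>\<^sub>s \<psi>1)"

fun riordan_prod ::
    "('a, 'm, 's) riordan_obj \<Rightarrow> ('a, 'n, 't) riordan_obj
     \<Rightarrow> ('a, ('a, 'm, ('a, 'n, 's) subst_str) prod_str, ('a, 't, 's) subst_str) riordan_obj"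
    (infixr "\<star>" 70) where
  "(M1, P1) \<star> (M2, P2) = (sp_prod M1 (sp_subst M2 P1), sp_subst P2 P1)"

fun riordan_prod_mor ::
    "('a, 'm, 's, 'm2, 's2) riordan_mor \<Rightarrow> ('a, 'n, 't, 'n2, 't2) riordan_mor
     \<Rightarrow> ('a, ('a, 'm, ('a, 'n, 's) subst_str) prod_str, ('a, 't, 's) subst_str,
         ('a, 'm2, ('a, 'n2, 's2) subst_str) prod_str, ('a, 't2, 's2) subst_str) riordan_mor"
    (infixr "\<star>\<^sub>m" 70) where
  "(\<phi>1, \<psi>1) \<star>\<^sub>m (\<phi>2, \<psi>2) = (prod_mor \<phi>1 (subst_mor \<phi>2 \<psi>1), subst_mor \<psi>2 \<psi>1)"

definition riordan_unit :: "('a, 'a label set, 'a label) riordan_obj" where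
  "riordan_unit = (sp_one, sp_X)"

text \<open>\<open>A \<star> (B \<star> C) \<rightarrow> (A \<star> B) \<star> C\<close>; in the first component
  \<open>M1 \<cdot> (M2 \<cdot> M3(P2))(P1) \<rightarrow> M1 \<cdot> (M2(P1) \<cdot> M3(P2)(P1)) \<rightarrow> M1 \<cdot> (M2(P1) \<cdot> M3(P2(P1)))
  \<rightarrow> (M1 \<cdot> M2(P1)) \<cdot> M3(P2(P1))\<close>. The first two objects enter only through their types.\<close>

fun riordan_assoc ::
    "('a, 'm1, 's1) riordan_obj \<Rightarrow> ('a, 'm2, 's2) riordan_obj \<Rightarrow> ('a, 'm3, 's3) riordan_obj
     \<Rightarrow> ('a,
         ('a, 'm1, ('a, ('a, 'm2, ('a, 'm3, 's2) subst_str) prod_str, 's1) subst_str) prod_str,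
         ('a, ('a, 's3, 's2) subst_str, 's1) subst_str,
         ('a, ('a, 'm1, ('a, 'm2, 's1) subst_str) prod_str, ('a, 'm3, ('a, 's2, 's1) subst_str) subst_str)
           prod_str,
         ('a, 's3, ('a, 's2, 's1) subst_str) subst_str) riordan_mor" where
  "riordan_assoc (M1, P1) (M2, P2) (M3, P3) =
     (prod_assoc \<circ>\<^sub>s prod_mor mor_id (prod_mor mor_id (subst_assoc M3)) \<circ>\<^sub>s prod_mor mor_id subst_distrib,
      subst_assoc P3)"

text \<open>\<open>(1, X) \<star> (M, P) = (1 \<cdot> M(X), P(X)) \<rightarrow> (M, P)\<close>\<close>

fun riordan_lunit ::
    "('a, 'm, 's) riordan_obj
     \<Rightarrow> ('a, ('a, 'a label set, ('a, 'm, 'a label) subst_str) prod_str, ('a, 's, 'a label) subst_str,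
         'm, 's) riordan_mor" where
  "riordan_lunit (M, P) = (subst_runit M \<circ>\<^sub>s prod_lunit, subst_runit P)"

text \<open>\<open>(M, P) \<star> (1, X) = (M \<cdot> 1(P), X(P)) \<rightarrow> (M, P)\<close>\<close>

definition riordan_runit ::
    "('a, ('a, 'm, ('a, 'a label set, 's) subst_str) prod_str, ('a, 'a label, 's) subst_str,
      'm, 's) riordan_mor" where
  "riordan_runit = (prod_runit \<circ>\<^sub>s prod_mor mor_id subst_one, subst_lunit)"

definition monop ::
    "('a, 'm, 's) riordan_obj
     \<Rightarrow> ('a, ('a, 'm, ('a, 'm, 's) subst_str) prod_str, ('a, 's, 's) subst_str, 'm, 's) riordan_mor
     \<Rightarrow> ('a, 'a label set, 'a label, 'm, 's) riordan_mor \<Rightarrow> bool" where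
  "monop A \<mu> \<iota> \<longleftrightarrow>
     is_riordan_obj A \<and>
     is_riordan_mor (A \<star> A) A \<mu> \<and> is_riordan_mor riordan_unit A \<iota> \<and>
     riordan_eq (A \<star> (A \<star> A))
       (\<mu> \<circ>\<^sub>R (\<mu> \<star>\<^sub>m riordan_id) \<circ>\<^sub>R riordan_assoc A A A)
       (\<mu> \<circ>\<^sub>R (riordan_id \<star>\<^sub>m \<mu>)) \<and>
     riordan_eq (riordan_unit \<star> A) (\<mu> \<circ>\<^sub>R (\<iota> \<star>\<^sub>m riordan_id)) (riordan_lunit A) \<and>
     riordan_eq (A \<star> riordan_unit) (\<mu> \<circ>\<^sub>R (riordan_id \<star>\<^sub>m \<iota>)) riordan_runit"

end

theory Submission
  imports Defs
begin

text \<open>The derivative is a monoidal functor \<open>F \<mapsto> (F', F)\<close> from positive species under substitution to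
  the Riordan category, the chain rule \<open>P' \<cdot> R'(P) \<rightarrow> (R(P))'\<close> being its structure map. A monoidal
  functor carries monoids to monoids, and the image of an operad is the monop in question. So the
  point is that the chain rule is natural in \<open>R\<close> and \<open>P\<close>, and coherent with the associativity and
  unit isomorphisms of the two products.\<close>

subsection \<open>Sets of blocks\<close>

lemma blk_eq_iff: "finite B \<Longrightarrow> finite C \<Longrightarrow> blk B = blk C \<longleftrightarrow> B = C"
  by (metis unblk_blk)

lemma blk_mem_image_iff:
  assumes "finite B" "\<And>C. C \<in> \<pi> \<Longrightarrow> finite C"
  shows "blk B \<in> blk ` \<pi> \<longleftrightarrow> B \<in> \<pi>"
  using assms by (metis blk_eq_iff image_iff)

lemma finite_partition_on:
  assumes "partition_on V \<pi>" "finite V"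
  shows "finite \<pi>" and "B \<in> \<pi> \<Longrightarrow> finite B"
proof -
  show "finite \<pi>"
    using assms by (metis finite_elements)
  show "B \<in> \<pi> \<Longrightarrow> finite B"
    using assms by (metis Union_upper finite_subset partition_onD1)
qed

lemma partition_on_disjoint_Un:
  assumes "partition_on V \<pi>" "B \<inter> V = {}" "B \<noteq> {}"
  shows "partition_on (B \<union> V) (insert B \<pi>)"
proof -
  have "B \<union> V - B = V"
    using assms(2) by blast
  then show ?thesis
    using assms partition_onD1[OF assms(1)] by (simp add: partition_on_insert disjnt_def)
qed

lemma partition_on_image:
  assumes "partition_on V \<pi>" "inj_on \<sigma> V"
  shows "partition_on (\<sigma> ` V) ((`) \<sigma> ` \<pi>)"
proof -
  have "(`) \<sigma> ` \<pi> - {{}} = (`) \<sigma> ` \<pi>"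
    using assms(1) by (auto simp: partition_on_def)
  then show ?thesis
    using partition_on_inj_image[OF assms] by simp
qed

lemma bij_betw_unblk:
  assumes "\<And>B. B \<in> \<pi> \<Longrightarrow> finite B"
  shows "bij_betw unblk (blk ` \<pi>) \<pi>"
  by (rule bij_betw_byWitness[where f' = blk]) (use assms in auto)

lemma block_image_cong:
  assumes "partition_on V \<pi>" "\<And>x. x \<in> V \<Longrightarrow> \<sigma> x = \<tau> x" "B \<in> \<pi>"
  shows "\<sigma> ` B = \<tau> ` B"
  using assms by (intro image_cong) (auto simp: partition_on_def)

lemma bij_betw_blk_map:
  assumes "inj_on h \<pi>" "\<And>B. B \<in> \<pi> \<Longrightarrow> finite B" "\<And>B. B \<in> \<pi> \<Longrightarrow> finite (h B)"
  shows "bij_betw (\<lambda>x. blk (h (unblk x))) (blk ` \<pi>) (blk ` h ` \<pi>)"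
proof (rule bij_betw_imageI)
  show "inj_on (\<lambda>x. blk (h (unblk x))) (blk ` \<pi>)"
    using assms by (auto simp: inj_on_def blk_eq_iff)
  show "(\<lambda>x. blk (h (unblk x))) ` blk ` \<pi> = blk ` h ` \<pi>"
    unfolding image_image using assms(2) by (intro image_cong) auto
qed

lemma bij_betw_blk_image:
  assumes "partition_on V \<pi>" "finite V" "inj_on \<sigma> V"
  shows "bij_betw (\<lambda>x. blk (\<sigma> ` unblk x)) (blk ` \<pi>) (blk ` (`) \<sigma> ` \<pi>)"
proof (rule bij_betw_blk_map)
  show "inj_on ((`) \<sigma>) \<pi>"
    using assms by (auto intro: inj_on_image simp: partition_on_def)
qed (use finite_partition_on[OF assms(1,2)] in auto)

lemma insert_notin_partition: "partition_on V \<pi> \<Longrightarrow> x \<notin> V \<Longrightarrow> insert x U \<notin> \<pi>"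
  by (auto simp: partition_on_def)

lemma blk_insert_notin_partition:
  assumes "partition_on V \<pi>" "finite V" "finite U" "x \<notin> V"
  shows "blk (insert x U) \<notin> blk ` \<pi>"
  using assms insert_notin_partition[of V \<pi> x U] finite_partition_on[of V \<pi>]
  by (simp add: blk_mem_image_iff)

abbreviation flat :: "'a label set \<Rightarrow> 'a label set" where
  "flat K \<equiv> \<Union>(unblk ` K)"

context
  fixes V :: "'a label set" and \<pi>
  assumes part: "partition_on V \<pi>" and V: "finite V"
begin

lemma unblk_in_partition: "x \<in> blk ` \<pi> \<Longrightarrow> unblk x \<in> \<pi>"
  using finite_partition_on[OF part V] by auto

lemma blk_image_unblk_image: "K \<subseteq> blk ` \<pi> \<Longrightarrow> blk ` unblk ` K = K"
  using finite_partition_on[OF part V] by (force simp: subset_iff image_iff)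

lemma unblk_image_subset: "K \<subseteq> blk ` \<pi> \<Longrightarrow> unblk ` K \<subseteq> \<pi>"
  using unblk_in_partition by blast

lemma flat_blk_image: "flat (blk ` \<pi>) = V"
  using finite_partition_on[OF part V] part by (force simp: partition_on_def)

lemma flat_subset: "K \<subseteq> blk ` \<pi> \<Longrightarrow> flat K \<subseteq> V"
  using flat_blk_image by blast

lemma finite_flat: "K \<subseteq> blk ` \<pi> \<Longrightarrow> finite (flat K)"
  using finite_subset[OF flat_subset V] .

lemma blocks_of_flat:
  assumes "K \<subseteq> blk ` \<pi>"
  shows "{B \<in> \<pi>. B \<subseteq> flat K} = unblk ` K"
proof (intro equalityI subsetI)
  fix B assume "B \<in> {B \<in> \<pi>. B \<subseteq> flat K}"
  then have B: "B \<in> \<pi>" "B \<subseteq> flat K" by auto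
  then obtain v where "v \<in> B"
    using part by (force simp: partition_on_def)
  then obtain x where "x \<in> K" "v \<in> unblk x" using B by blast
  then have "unblk x = B"
    using disjointD[OF partition_onD2[OF part] unblk_in_partition[of x] B(1)] \<open>v \<in> B\<close> assms
    by blast
  then show "B \<in> unblk ` K" using \<open>x \<in> K\<close> by blast
qed (use assms unblk_image_subset in auto)

lemma inj_on_flat: "inj_on flat (Pow (blk ` \<pi>))"
  by (rule inj_on_inverseI[where g = "\<lambda>D. blk ` {B \<in> \<pi>. B \<subseteq> D}"])
    (simp add: blocks_of_flat blk_image_unblk_image)

lemma flat_disjoint:
  assumes "K \<subseteq> blk ` \<pi>" "L \<subseteq> blk ` \<pi>" "K \<inter> L = {}"
  shows "flat K \<inter> flat L = {}"
proof -
  have "unblk x \<inter> unblk y = {}" if "x \<in> K" "y \<in> L" for x y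
  proof (rule disjointD[OF partition_onD2[OF part]])
    show "unblk x \<in> \<pi>" "unblk y \<in> \<pi>"
      using that assms unblk_in_partition by auto
    show "unblk x \<noteq> unblk y"
      using that assms finite_partition_on[OF part V] by force
  qed
  then show ?thesis by blast
qed

lemma partition_on_unblk_image:
  assumes "K \<subseteq> blk ` \<pi>"
  shows "partition_on (flat K) (unblk ` K)"
  using part unblk_image_subset[OF assms]
  unfolding partition_on_def by (auto intro: pairwise_subset)

lemma partition_on_flat:
  assumes "partition_on (blk ` \<pi>) \<kappa>"
  shows "partition_on V (flat ` \<kappa>)"
proof (rule partition_onI)
  have sub: "K \<subseteq> blk ` \<pi>" if "K \<in> \<kappa>" for K
    using assms that by (auto simp: partition_on_def)
  show "\<Union>(flat ` \<kappa>) = V"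
    using flat_blk_image partition_onD1[OF assms] by auto
  show "disjnt D E" if "D \<in> flat ` \<kappa>" "E \<in> flat ` \<kappa>" "D \<noteq> E" for D E
  proof -
    obtain K L where KL: "K \<in> \<kappa>" "D = flat K" "L \<in> \<kappa>" "E = flat L" "K \<noteq> L"
      using \<open>D \<in> flat ` \<kappa>\<close> \<open>E \<in> flat ` \<kappa>\<close> \<open>D \<noteq> E\<close> by blast
    then have "K \<inter> L = {}"
      using partition_onD2[OF assms] by (auto dest: disjointD)
    then show ?thesis
      unfolding disjnt_def KL(2,4) using KL sub by (intro flat_disjoint) auto
  qed
  show "{} \<notin> flat ` \<kappa>"
  proof
    assume "{} \<in> flat ` \<kappa>"
    then obtain K where K: "K \<in> \<kappa>" "{} = flat K" by (rule imageE)
    then have "K = {}"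
      using inj_onD[OF inj_on_flat, of K "{}"] sub by simp
    then show False using K(1) partition_onD3[OF assms] by simp
  qed
qed

end


subsection \<open>Transport\<close>

lemma is_speciesI:
  assumes "\<And>U. finite U \<Longrightarrow> finite (str F U)"
    and "\<And>U W \<sigma> s. \<lbrakk>finite U; bij_betw \<sigma> U W; s \<in> str F U\<rbrakk> \<Longrightarrow> tr F U \<sigma> s \<in> str F W"
    and "\<And>U \<sigma> \<tau> s. \<lbrakk>finite U; inj_on \<sigma> U; \<forall>x\<in>U. \<sigma> x = \<tau> x; s \<in> str F U\<rbrakk>
      \<Longrightarrow> tr F U \<sigma> s = tr F U \<tau> s"
    and "\<And>U s. \<lbrakk>finite U; s \<in> str F U\<rbrakk> \<Longrightarrow> tr F U id s = s"
    and "\<And>U W \<sigma> \<tau> s. \<lbrakk>finite U; bij_betw \<sigma> U W; inj_on \<tau> W; s \<in> str F U\<rbrakk>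
      \<Longrightarrow> tr F U (\<tau> \<circ> \<sigma>) s = tr F W \<tau> (tr F U \<sigma> s)"
  shows "is_species F"
  unfolding is_species_def
proof (intro conjI allI impI ballI)
  fix U :: "'a label set" and \<sigma> \<tau> :: "'a label \<Rightarrow> 'a label" and s
  assume "finite U" "inj_on \<sigma> U" "inj_on \<tau> (\<sigma> ` U)" "s \<in> str F U"
  then show "tr F U (\<tau> \<circ> \<sigma>) s = tr F (\<sigma> ` U) \<tau> (tr F U \<sigma> s)"
    by (intro assms(5)) (auto simp: bij_betw_def)
qed (auto intro: assms simp: bij_betw_def)

lemma finite_str: "is_species F \<Longrightarrow> finite U \<Longrightarrow> finite (str F U)"
  by (simp add: is_species_def)

lemma tr_in:
  assumes "is_species F" "finite U" "bij_betw \<sigma> U W" "s \<in> str F U"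
  shows "tr F U \<sigma> s \<in> str F W"
proof -
  have "\<forall>U \<sigma>. finite U \<longrightarrow> inj_on \<sigma> U \<longrightarrow> (\<forall>s\<in>str F U. tr F U \<sigma> s \<in> str F (\<sigma> ` U))"
    using assms(1) unfolding is_species_def by (elim conjE)
  then show ?thesis
    using assms(2-4) by (auto simp: bij_betw_def)
qed

lemma tr_cong:
  assumes "is_species F" "finite U" "inj_on \<sigma> U" "s \<in> str F U" "\<And>x. x \<in> U \<Longrightarrow> \<sigma> x = \<tau> x"
  shows "tr F U \<sigma> s = tr F U \<tau> s"
proof -
  have "\<forall>U \<sigma> \<tau>. finite U \<longrightarrow> inj_on \<sigma> U \<longrightarrow> (\<forall>x\<in>U. \<sigma> x = \<tau> x) \<longrightarrow>
      (\<forall>s\<in>str F U. tr F U \<sigma> s = tr F U \<tau> s)"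
    using assms(1) unfolding is_species_def by (elim conjE)
  then show ?thesis
    using assms(2-5) by blast
qed

lemma tr_ident:
  assumes "is_species F" "finite U" "s \<in> str F U" "\<And>x. x \<in> U \<Longrightarrow> \<sigma> x = x"
  shows "tr F U \<sigma> s = s"
proof -
  have "\<forall>U. finite U \<longrightarrow> (\<forall>s\<in>str F U. tr F U id s = s)"
    using assms(1) unfolding is_species_def by (elim conjE)
  moreover have "tr F U id s = tr F U \<sigma> s"
    using assms by (intro tr_cong) auto
  ultimately show ?thesis
    using assms(2,3) by simp
qed

lemma tr_tr:
  assumes "is_species F" "finite U" "bij_betw \<sigma> U W" "inj_on \<tau> W" "s \<in> str F U"
    and "\<And>x. x \<in> U \<Longrightarrow> \<tau> (\<sigma> x) = \<upsilon> x"
  shows "tr F W \<tau> (tr F U \<sigma> s) = tr F U \<upsilon> s"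
proof -
  have \<sigma>: "inj_on \<sigma> U" "\<sigma> ` U = W"
    using assms(3) by (auto simp: bij_betw_def)
  have "\<forall>U \<sigma> \<tau>. finite U \<longrightarrow> inj_on \<sigma> U \<longrightarrow> inj_on \<tau> (\<sigma> ` U) \<longrightarrow>
      (\<forall>s\<in>str F U. tr F U (\<tau> \<circ> \<sigma>) s = tr F (\<sigma> ` U) \<tau> (tr F U \<sigma> s))"
    using assms(1) unfolding is_species_def by (elim conjE)
  then have "tr F W \<tau> (tr F U \<sigma> s) = tr F U (\<tau> \<circ> \<sigma>) s"
    using assms(2,4,5) \<sigma> by metis
  also have "\<dots> = tr F U \<upsilon> s"
    using assms \<sigma> by (intro tr_cong) (auto intro: comp_inj_on)
  finally show ?thesis .
qed

lemma is_species_X: "is_species sp_X"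
  by (rule is_speciesI) (auto simp: sp_X_def bij_betw_same_card bij_betwE split: if_splits)


subsection \<open>Equations between morphisms\<close>

text \<open>Only this half of \<open>is_mor\<close> is needed of the canonical isomorphisms, in order to precompose an
  equation with them.\<close>

definition maps_str :: "('a, 's) species \<Rightarrow> ('a, 't) species \<Rightarrow> ('a, 's, 't) mor \<Rightarrow> bool" where
  "maps_str F G \<phi> \<longleftrightarrow> (\<forall>U. finite U \<longrightarrow> (\<forall>s\<in>str F U. \<phi> U s \<in> str G U))"

lemma maps_strI:
  assumes "\<And>U s. finite U \<Longrightarrow> s \<in> str F U \<Longrightarrow> \<phi> U s \<in> str G U"
  shows "maps_str F G \<phi>"
  using assms by (simp add: maps_str_def)

lemma maps_strD: "maps_str F G \<phi> \<Longrightarrow> finite U \<Longrightarrow> s \<in> str F U \<Longrightarrow> \<phi> U s \<in> str G U"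
  by (simp add: maps_str_def)

lemma is_morI:
  assumes "maps_str F G \<phi>"
    and "\<And>U W \<sigma> s. \<lbrakk>finite U; bij_betw \<sigma> U W; s \<in> str F U\<rbrakk>
      \<Longrightarrow> \<phi> W (tr F U \<sigma> s) = tr G U \<sigma> (\<phi> U s)"
  shows "is_mor F G \<phi>"
  using assms by (simp add: is_mor_def maps_str_def bij_betw_def)

lemma is_mor_maps_str: "is_mor F G \<phi> \<Longrightarrow> maps_str F G \<phi>"
  by (simp add: is_mor_def maps_str_def)

lemma mor_natural:
  assumes "is_mor F G \<phi>" "finite U" "bij_betw \<sigma> U W" "s \<in> str F U"
  shows "\<phi> W (tr F U \<sigma> s) = tr G U \<sigma> (\<phi> U s)"
  using assms unfolding is_mor_def by (auto simp: bij_betw_def)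

lemma mor_comp_assoc: "\<phi> \<circ>\<^sub>s (\<psi> \<circ>\<^sub>s \<chi>) = \<phi> \<circ>\<^sub>s \<psi> \<circ>\<^sub>s \<chi>"
  by (simp add: mor_comp_def fun_eq_iff)

lemma mor_id_comp [simp]: "mor_id \<circ>\<^sub>s \<phi> = \<phi>" and mor_comp_id [simp]: "\<phi> \<circ>\<^sub>s mor_id = \<phi>"
  by (simp_all add: mor_comp_def mor_id_def fun_eq_iff)

lemma maps_str_id: "maps_str F F mor_id"
  by (simp add: maps_str_def mor_id_def)

lemma maps_str_comp: "maps_str G H \<phi> \<Longrightarrow> maps_str F G \<psi> \<Longrightarrow> maps_str F H (\<phi> \<circ>\<^sub>s \<psi>)"
  by (simp add: maps_str_def mor_comp_def)

lemma is_mor_id: "is_mor F F mor_id"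
  by (simp add: is_mor_def mor_id_def)

lemma is_mor_comp:
  assumes \<phi>: "is_mor G H \<phi>" and \<psi>: "is_mor F G \<psi>"
  shows "is_mor F H (\<phi> \<circ>\<^sub>s \<psi>)"
proof (rule is_morI)
  fix U W :: "'a label set" and \<sigma> s
  assume s: "finite U" "bij_betw \<sigma> U W" "s \<in> str F U"
  then have "\<psi> U s \<in> str G U"
    using is_mor_maps_str[OF \<psi>] by (simp add: maps_strD)
  then show "(\<phi> \<circ>\<^sub>s \<psi>) W (tr F U \<sigma> s) = tr H U \<sigma> ((\<phi> \<circ>\<^sub>s \<psi>) U s)"
    using s by (simp add: mor_comp_def mor_natural[OF \<psi>] mor_natural[OF \<phi>])
qed (rule maps_str_comp[OF is_mor_maps_str[OF \<phi>] is_mor_maps_str[OF \<psi>]])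

lemma mor_eq_trans [trans]: "mor_eq F \<phi> \<psi> \<Longrightarrow> mor_eq F \<psi> \<chi> \<Longrightarrow> mor_eq F \<phi> \<chi>"
  by (simp add: mor_eq_def)

lemma mor_eq_sym: "mor_eq F \<phi> \<psi> \<Longrightarrow> mor_eq F \<psi> \<phi>"
  by (simp add: mor_eq_def)

lemma mor_eq_comp_left: "mor_eq F \<phi> \<psi> \<Longrightarrow> mor_eq F (\<chi> \<circ>\<^sub>s \<phi>) (\<chi> \<circ>\<^sub>s \<psi>)"
  by (simp add: mor_eq_def mor_comp_def)

lemma mor_eq_comp_right: "mor_eq G \<phi> \<psi> \<Longrightarrow> maps_str F G \<chi> \<Longrightarrow> mor_eq F (\<phi> \<circ>\<^sub>s \<chi>) (\<psi> \<circ>\<^sub>s \<chi>)"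
  by (simp add: mor_eq_def mor_comp_def maps_str_def)


subsection \<open>The derivative\<close>

lemma finite_plus_star: "finite U \<Longrightarrow> finite (plus_star U)"
  by (simp add: plus_star_def)

lemma bij_betw_fun_upd:
  assumes "bij_betw \<sigma> U W" "x \<notin> U" "y \<notin> W"
  shows "bij_betw (\<sigma>(x := y)) (insert x U) (insert y W)"
proof -
  have "bij_betw (\<sigma>(x := y)) U W"
    using assms by (subst bij_betw_cong[where g = \<sigma>]) auto
  then show ?thesis
    using assms notIn_Un_bij_betw[of x U "\<sigma>(x := y)" W] by simp
qed

lemma bij_betw_star_upd:
  assumes "finite U" "bij_betw \<sigma> U W" "y \<notin> W"
  shows "bij_betw (\<sigma>(star U := y)) (plus_star U) (insert y W)"
  unfolding plus_star_def using assms star_notin by (intro bij_betw_fun_upd)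

lemma bij_betw_plus_star:
  assumes "finite U" "bij_betw \<sigma> U W"
  shows "bij_betw (\<sigma>(star U := star W)) (plus_star U) (plus_star W)"
  unfolding plus_star_def[of W]
  using assms star_notin bij_betw_finite by (intro bij_betw_star_upd) auto

lemma str_deriv: "str (deriv F) U = str F (plus_star U)"
  by (simp add: deriv_def)

lemma tr_deriv:
  "bij_betw \<sigma> U W \<Longrightarrow> tr (deriv F) U \<sigma> = tr F (plus_star U) (\<sigma>(star U := star W))"
  by (auto simp: deriv_def bij_betw_def)

lemma is_species_deriv:
  assumes F: "is_species F"
  shows "is_species (deriv F)"
proof (rule is_speciesI)
  fix U W :: "'a label set" and \<sigma> s
  assume "finite U" "bij_betw \<sigma> U W" "s \<in> str (deriv F) U"
  then show "tr (deriv F) U \<sigma> s \<in> str (deriv F) W"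
    by (auto simp: str_deriv tr_deriv intro!: tr_in[OF F] finite_plus_star bij_betw_plus_star)
next
  fix U :: "'a label set" and \<sigma> \<tau> :: "'a label \<Rightarrow> 'a label" and s
  assume U: "finite U" and inj: "inj_on \<sigma> U" and eq: "\<forall>x\<in>U. \<sigma> x = \<tau> x" and s: "s \<in> str (deriv F) U"
  have \<sigma>: "bij_betw \<sigma> U (\<sigma> ` U)" and \<tau>: "bij_betw \<tau> U (\<sigma> ` U)"
    using inj eq by (auto simp: bij_betw_def inj_on_def)
  show "tr (deriv F) U \<sigma> s = tr (deriv F) U \<tau> s"
    unfolding tr_deriv[OF \<sigma>] tr_deriv[OF \<tau>]
  proof (rule tr_cong[OF F])
    show "inj_on (\<sigma>(star U := star (\<sigma> ` U))) (plus_star U)"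
      using bij_betw_plus_star[OF U \<sigma>] by (rule bij_betw_imp_inj_on)
  qed (use U eq s in \<open>auto simp: str_deriv finite_plus_star plus_star_def\<close>)
next
  fix U W :: "'a label set" and \<sigma> \<tau> :: "'a label \<Rightarrow> 'a label" and s
  assume U: "finite U" and \<sigma>: "bij_betw \<sigma> U W" and inj: "inj_on \<tau> W" and s: "s \<in> str (deriv F) U"
  have \<tau>: "bij_betw \<tau> W (\<tau> ` W)" and W: "finite W"
    using U inj bij_betw_finite[OF \<sigma>] by (simp_all add: inj_on_imp_bij_betw)
  show "tr (deriv F) U (\<tau> \<circ> \<sigma>) s = tr (deriv F) W \<tau> (tr (deriv F) U \<sigma> s)"
    unfolding tr_deriv[OF \<sigma>] tr_deriv[OF \<tau>] tr_deriv[OF bij_betw_trans[OF \<sigma> \<tau>]]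
  proof (rule tr_tr[OF F, symmetric])
    show "inj_on (\<tau>(star W := star (\<tau> ` W))) (plus_star W)"
      using bij_betw_plus_star[OF W \<tau>] by (rule bij_betw_imp_inj_on)
    fix x assume "x \<in> plus_star U"
    then have "x \<noteq> star U \<Longrightarrow> \<sigma> x \<in> W"
      using \<sigma> by (auto simp: plus_star_def bij_betwE)
    then show "(\<tau>(star W := star (\<tau> ` W))) ((\<sigma>(star U := star W)) x) =
        ((\<tau> \<circ> \<sigma>)(star U := star (\<tau> ` W))) x"
      using star_notin[OF W] by auto
  qed (use U \<sigma> s in \<open>simp_all add: str_deriv finite_plus_star bij_betw_plus_star
        del: fun_upd_apply\<close>)
qed (auto simp: str_deriv deriv_def finite_plus_star finite_str[OF F] tr_ident[OF F])

lemma maps_str_deriv_mor: "maps_str F G \<phi> \<Longrightarrow> maps_str (deriv F) (deriv G) (deriv_mor \<phi>)"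
  by (simp add: maps_str_def str_deriv deriv_mor_def finite_plus_star)

lemma is_mor_deriv_mor:
  assumes "is_mor F G \<phi>"
  shows "is_mor (deriv F) (deriv G) (deriv_mor \<phi>)"
proof (rule is_morI)
  fix U W :: "'a label set" and \<sigma> s
  assume "finite U" "bij_betw \<sigma> U W" "s \<in> str (deriv F) U"
  then show "deriv_mor \<phi> W (tr (deriv F) U \<sigma> s) = tr (deriv G) U \<sigma> (deriv_mor \<phi> U s)"
    by (simp add: tr_deriv str_deriv deriv_mor_def finite_plus_star bij_betw_plus_star
        mor_natural[OF assms])
qed (intro maps_str_deriv_mor is_mor_maps_str assms)

lemma deriv_mor_id [simp]: "deriv_mor mor_id = mor_id"
  by (simp add: deriv_mor_def mor_id_def fun_eq_iff)

lemma deriv_mor_comp: "deriv_mor (\<phi> \<circ>\<^sub>s \<psi>) = deriv_mor \<phi> \<circ>\<^sub>s deriv_mor \<psi>"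
  by (simp add: deriv_mor_def mor_comp_def fun_eq_iff)

lemma mor_eq_deriv_mor: "mor_eq F \<phi> \<psi> \<Longrightarrow> mor_eq (deriv F) (deriv_mor \<phi>) (deriv_mor \<psi>)"
  by (simp add: mor_eq_def str_deriv deriv_mor_def finite_plus_star)

lemma is_mor_one_deriv_X: "is_mor sp_one (deriv sp_X) one_deriv_X"
proof (rule is_morI)
  show "maps_str sp_one (deriv sp_X) one_deriv_X"
    by (rule maps_strI)
      (auto simp: sp_one_def str_deriv plus_star_def sp_X_def one_deriv_X_def split: if_splits)
  fix U W :: "'a label set" and \<sigma> s
  assume \<sigma>: "bij_betw \<sigma> U W"
  show "one_deriv_X W (tr sp_one U \<sigma> s) = tr (deriv sp_X) U \<sigma> (one_deriv_X U s)"
    by (simp add: tr_deriv[OF \<sigma>] one_deriv_X_def sp_X_def)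
qed

definition repoint :: "('a, 's) species \<Rightarrow> 'a label set \<Rightarrow> 'a label \<Rightarrow> 's \<Rightarrow> 's" where
  "repoint F U x s = tr F (plus_star U) (id(star U := x)) s"

lemma repoint_in:
  assumes "is_species F" "finite U" "x \<notin> U" "s \<in> str (deriv F) U"
  shows "repoint F U x s \<in> str F (insert x U)"
  unfolding repoint_def
  by (rule tr_in) (use assms in \<open>simp_all add: finite_plus_star str_deriv bij_betw_star_upd\<close>)

lemma repoint_star:
  assumes "is_species F" "finite U" "s \<in> str (deriv F) U"
  shows "repoint F U (star U) s = s"
  unfolding repoint_def
  by (rule tr_ident) (use assms in \<open>auto simp: finite_plus_star str_deriv\<close>)

lemma tr_repoint:
  assumes F: "is_species F" and U: "finite U" and s: "s \<in> str (deriv F) U"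
    and \<sigma>: "bij_betw \<sigma> U W" and xy: "x \<notin> U" "y \<notin> W"
    and \<tau>: "\<And>u. u \<in> U \<Longrightarrow> \<tau> u = \<sigma> u" "\<tau> x = y"
  shows "tr F (insert x U) \<tau> (repoint F U x s) = repoint F W y (tr (deriv F) U \<sigma> s)"
proof -
  have s': "s \<in> str F (plus_star U)" and W: "finite W"
    using s \<sigma> U bij_betw_finite by (auto simp: str_deriv)
  have "tr F (insert x U) \<tau> (repoint F U x s) = tr F (plus_star U) (\<sigma>(star U := y)) s"
    unfolding repoint_def
  proof (rule tr_tr[OF F _ _ _ s'])
    have "bij_betw \<tau> (insert x U) (insert y W)"
      using bij_betw_fun_upd[OF \<sigma> xy] \<tau> by (subst bij_betw_cong[where g = "\<sigma>(x := y)"]) auto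
    then show "inj_on \<tau> (insert x U)" by (rule bij_betw_imp_inj_on)
    show "\<tau> ((id(star U := x)) u) = (\<sigma>(star U := y)) u" if "u \<in> plus_star U" for u
      using that \<tau> by (auto simp: plus_star_def)
  qed (use U xy in \<open>simp_all add: finite_plus_star bij_betw_star_upd\<close>)
  also have "\<dots> = repoint F W y (tr (deriv F) U \<sigma> s)"
    unfolding repoint_def tr_deriv[OF \<sigma>]
  proof (rule tr_tr[OF F _ _ _ s', symmetric])
    show "inj_on (id(star W := y)) (plus_star W)"
      using bij_betw_star_upd[OF W bij_betw_id xy(2)] by (rule bij_betw_imp_inj_on)
    fix u assume "u \<in> plus_star U"
    then have "u \<noteq> star U \<Longrightarrow> \<sigma> u \<in> W"
      using \<sigma> by (auto simp: plus_star_def bij_betwE)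
    then show "(id(star W := y)) ((\<sigma>(star U := star W)) u) = (\<sigma>(star U := y)) u"
      using star_notin[OF W] by auto
  qed (use U in \<open>simp_all add: finite_plus_star bij_betw_plus_star \<sigma>\<close>)
  finally show ?thesis .
qed

lemma tr_repoint_blk:
  assumes F: "is_species F" and fin: "finite \<pi>" "\<And>C. C \<in> insert B \<pi> \<Longrightarrow> finite C \<and> finite (h C)"
    and B: "B \<notin> \<pi>" and h: "inj_on h (insert B \<pi>)" and k: "\<And>C. C \<in> \<pi> \<Longrightarrow> k C = h C"
    and s: "s \<in> str (deriv F) (blk ` \<pi>)"
  shows "tr F (insert (blk B) (blk ` \<pi>)) (\<lambda>x. blk (h (unblk x))) (repoint F (blk ` \<pi>) (blk B) s) =
    repoint F (blk ` k ` \<pi>) (blk (h B)) (tr (deriv F) (blk ` \<pi>) (\<lambda>x. blk (k (unblk x))) s)"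
proof (rule tr_repoint[OF F _ s])
  have "inj_on k \<pi>"
    using h k by (auto simp: inj_on_def)
  then show "bij_betw (\<lambda>x. blk (k (unblk x))) (blk ` \<pi>) (blk ` k ` \<pi>)"
    using fin(2) k by (intro bij_betw_blk_map) auto
  show "blk B \<notin> blk ` \<pi>"
    using fin(2) B by (simp add: blk_mem_image_iff)
  have "h B \<noteq> h C" if "C \<in> \<pi>" for C
    using B h that by (auto simp: inj_on_def)
  then have "blk (h B) \<noteq> blk (k C)" if "C \<in> \<pi>" for C
    using fin(2) k that by (simp add: blk_eq_iff)
  then show "blk (h B) \<notin> blk ` k ` \<pi>"
    by blast
qed (use fin k in auto)

lemma mor_repoint:
  assumes "is_mor F G \<phi>" "finite U" "x \<notin> U" "s \<in> str (deriv F) U"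
  shows "\<phi> (insert x U) (repoint F U x s) = repoint G U x (deriv_mor \<phi> U s)"
  unfolding repoint_def deriv_mor_def using assms
  by (intro mor_natural bij_betw_star_upd) (simp_all add: finite_plus_star str_deriv)


subsection \<open>Product and substitution\<close>

lemma in_str_prod:
  "((V1, V2), (m, n)) \<in> str (sp_prod M N) V \<longleftrightarrow>
     V1 \<union> V2 = V \<and> V1 \<inter> V2 = {} \<and> m \<in> str M V1 \<and> n \<in> str N V2"
  by (auto simp: sp_prod_def)

lemma str_prodE:
  assumes "s \<in> str (sp_prod M N) V"
  obtains V1 V2 m n where "s = ((V1, V2), (m, n))" "V = V1 \<union> V2" "V1 \<inter> V2 = {}"
    "m \<in> str M V1" "n \<in> str N V2"
  using assms by (auto simp: sp_prod_def)

lemma maps_str_prod_mor: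
  "maps_str M M' \<phi> \<Longrightarrow> maps_str N N' \<psi> \<Longrightarrow>
    maps_str (sp_prod M N) (sp_prod M' N') (prod_mor \<phi> \<psi>)"
  by (auto simp: maps_str_def prod_mor_def in_str_prod elim!: str_prodE)

lemma prod_mor_comp:
  "prod_mor \<phi> \<psi> \<circ>\<^sub>s prod_mor \<phi>' \<psi>' = prod_mor (\<phi> \<circ>\<^sub>s \<phi>') (\<psi> \<circ>\<^sub>s \<psi>')"
  by (auto simp: prod_mor_def mor_comp_def fun_eq_iff)

lemma in_str_subst:
  "(\<pi>, f, r) \<in> str (sp_subst R P) V \<longleftrightarrow>
     partition_on V \<pi> \<and> f \<in> (\<Pi>\<^sub>E B\<in>\<pi>. str P B) \<and> r \<in> str R (blk ` \<pi>)"
  by (simp add: sp_subst_def)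

lemma str_substE:
  assumes "s \<in> str (sp_subst R P) V"
  obtains \<pi> f r where "s = (\<pi>, f, r)" "partition_on V \<pi>" "f \<in> (\<Pi>\<^sub>E B\<in>\<pi>. str P B)"
    "r \<in> str R (blk ` \<pi>)"
  using assms by (auto simp: sp_subst_def)

lemma maps_str_subst_mor:
  assumes \<phi>: "maps_str R R' \<phi>" and \<psi>: "maps_str P P' \<psi>"
  shows "maps_str (sp_subst R P) (sp_subst R' P') (subst_mor \<phi> \<psi>)"
proof (rule maps_strI)
  fix V s assume V: "finite V" and "s \<in> str (sp_subst R P) V"
  then obtain \<pi> f r where s: "s = (\<pi>, f, r)" "partition_on V \<pi>"
    "f \<in> (\<Pi>\<^sub>E B\<in>\<pi>. str P B)" "r \<in> str R (blk ` \<pi>)" by (elim str_substE)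
  note finite_partition_on[OF s(2) V]
  then show "subst_mor \<phi> \<psi> V s \<in> str (sp_subst R' P') V"
    using s maps_strD[OF \<phi>] maps_strD[OF \<psi>] by (auto simp: subst_mor_def in_str_subst PiE_iff)
qed

lemma subst_mor_comp:
  "subst_mor \<phi> \<psi> \<circ>\<^sub>s subst_mor \<phi>' \<psi>' = subst_mor (\<phi> \<circ>\<^sub>s \<phi>') (\<psi> \<circ>\<^sub>s \<psi>')"
  by (auto simp: subst_mor_def mor_comp_def fun_eq_iff restrict_def)

definition tr_blocks ::
    "('a, 't) species \<Rightarrow> 'a label set \<Rightarrow> ('a label \<Rightarrow> 'a label) \<Rightarrow> 'a label set set
     \<Rightarrow> ('a label set \<Rightarrow> 't) \<Rightarrow> 'a label set \<Rightarrow> 't" where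
  "tr_blocks P V \<sigma> \<pi> f = (\<lambda>C\<in>(`) \<sigma> ` \<pi>. let B = {x \<in> V. \<sigma> x \<in> C} in tr P B \<sigma> (f B))"

lemma tr_subst_eq:
  "tr (sp_subst R P) V \<sigma> (\<pi>, f, r) =
    ((`) \<sigma> ` \<pi>, tr_blocks P V \<sigma> \<pi> f, tr R (blk ` \<pi>) (\<lambda>x. blk (\<sigma> ` unblk x)) r)"
  by (simp add: sp_subst_def tr_blocks_def)

lemma tr_blocks_extensional: "tr_blocks P V \<sigma> \<pi> f \<in> extensional ((`) \<sigma> ` \<pi>)"
  by (simp add: tr_blocks_def)

lemma tr_blocks_image:
  assumes "partition_on V \<pi>" "inj_on \<sigma> V" "B \<in> \<pi>"
  shows "tr_blocks P V \<sigma> \<pi> f (\<sigma> ` B) = tr P B \<sigma> (f B)"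
proof -
  have "{x \<in> V. \<sigma> x \<in> \<sigma> ` B} = B"
    using assms by (auto simp: partition_on_def inj_on_def)
  then show ?thesis
    using assms(3) by (simp add: tr_blocks_def)
qed

lemma tr_blocks_eqI:
  assumes "partition_on V \<pi>" "inj_on \<sigma> V" "g \<in> extensional ((`) \<sigma> ` \<pi>)"
    and "\<And>B. B \<in> \<pi> \<Longrightarrow> g (\<sigma> ` B) = tr P B \<sigma> (f B)"
  shows "tr_blocks P V \<sigma> \<pi> f = g"
  by (rule extensionalityI[OF tr_blocks_extensional assms(3)])
    (auto simp: tr_blocks_image[OF assms(1,2)] assms(4))

lemma bij_betw_block:
  "partition_on V \<pi> \<Longrightarrow> inj_on \<sigma> V \<Longrightarrow> B \<in> \<pi> \<Longrightarrow> bij_betw \<sigma> B (\<sigma> ` B)"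
  by (auto simp: partition_on_def intro!: inj_on_imp_bij_betw intro: inj_on_subset)

lemma tr_blocks_insert:
  assumes part: "partition_on V \<pi>" and B: "B \<inter> V = {}" "B \<noteq> {}" and \<sigma>: "inj_on \<sigma> (B \<union> V)"
  shows "tr_blocks P (B \<union> V) \<sigma> (insert B \<pi>) (f(B := p)) =
    (tr_blocks P V \<sigma> \<pi> f)(\<sigma> ` B := tr P B \<sigma> p)"
proof (rule tr_blocks_eqI[OF partition_on_disjoint_Un[OF part B] \<sigma>])
  show "(tr_blocks P V \<sigma> \<pi> f)(\<sigma> ` B := tr P B \<sigma> p) \<in> extensional ((`) \<sigma> ` insert B \<pi>)"
    using tr_blocks_extensional[of P V \<sigma> \<pi> f] by (auto simp: extensional_def)
  have inj: "inj_on \<sigma> V"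
    using \<sigma> by (rule inj_on_subset) simp
  fix C assume "C \<in> insert B \<pi>"
  then consider (new) "C = B" | (old) "C \<in> \<pi>" "C \<noteq> B" by blast
  then show "((tr_blocks P V \<sigma> \<pi> f)(\<sigma> ` B := tr P B \<sigma> p)) (\<sigma> ` C) = tr P C \<sigma> ((f(B := p)) C)"
  proof cases
    case old
    then have "C \<subseteq> V"
      using part by (auto simp: partition_on_def)
    then have "\<sigma> ` C \<noteq> \<sigma> ` B"
      using old inj_on_image_eq_iff[OF \<sigma>, of C B] by auto
    then show ?thesis
      using old by (simp add: tr_blocks_image[OF part inj])
  qed simp
qed

lemma finite_str_subst:
  assumes R: "is_species R" and P: "is_species P" and V: "finite V"
  shows "finite (str (sp_subst R P) V)"
proof (rule finite_subset)
  let ?T = "SIGMA \<pi>:{\<pi>. partition_on V \<pi>}. (\<Pi>\<^sub>E B\<in>\<pi>. str P B) \<times> str R (blk ` \<pi>)"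
  show "str (sp_subst R P) V \<subseteq> ?T"
    by (auto elim: str_substE)
  show "finite ?T"
    using V finite_partition_on
    by (intro finite_SigmaI finitely_many_partition_on finite_cartesian_product finite_PiE
        finite_str[OF P] finite_str[OF R]) auto
qed

lemma tr_subst_in:
  assumes R: "is_species R" and P: "is_species P" and V: "finite V"
    and \<sigma>: "bij_betw \<sigma> V W" and s: "s \<in> str (sp_subst R P) V"
  shows "tr (sp_subst R P) V \<sigma> s \<in> str (sp_subst R P) W"
proof -
  obtain \<pi> f r where seq: "s = (\<pi>, f, r)" and part: "partition_on V \<pi>"
    and f: "f \<in> (\<Pi>\<^sub>E B\<in>\<pi>. str P B)" and r: "r \<in> str R (blk ` \<pi>)"
    using s by (elim str_substE)
  note fin = finite_partition_on[OF part V]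
  have inj: "inj_on \<sigma> V" and W: "W = \<sigma> ` V"
    using \<sigma> by (auto simp: bij_betw_def)
  have "tr P B \<sigma> (f B) \<in> str P (\<sigma> ` B)" if "B \<in> \<pi>" for B
    using f that by (intro tr_in[OF P fin(2) bij_betw_block[OF part inj]]) auto
  then have "tr_blocks P V \<sigma> \<pi> f \<in> (\<Pi>\<^sub>E B\<in>(`) \<sigma> ` \<pi>. str P B)"
    using tr_blocks_extensional by (auto simp: PiE_iff tr_blocks_image[OF part inj])
  moreover have "tr R (blk ` \<pi>) (\<lambda>x. blk (\<sigma> ` unblk x)) r \<in> str R (blk ` (`) \<sigma> ` \<pi>)"
    using fin(1) r by (intro tr_in[OF R _ bij_betw_blk_image[OF part V inj]]) simp_all
  ultimately show ?thesis
    using partition_on_image[OF part inj] by (simp add: seq tr_subst_eq in_str_subst W)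
qed

lemma tr_blocks_cong:
  assumes P: "is_species P" and V: "finite V" and part: "partition_on V \<pi>"
    and f: "f \<in> (\<Pi>\<^sub>E B\<in>\<pi>. str P B)" and \<sigma>: "inj_on \<sigma> V" "\<And>x. x \<in> V \<Longrightarrow> \<sigma> x = \<tau> x"
  shows "tr_blocks P V \<sigma> \<pi> f = tr_blocks P V \<tau> \<pi> f"
proof (rule tr_blocks_eqI[OF part \<sigma>(1)])
  have \<tau>: "inj_on \<tau> V"
    using \<sigma> inj_on_cong[of V \<sigma> \<tau>] by blast
  have im: "\<sigma> ` B = \<tau> ` B" if "B \<in> \<pi>" for B
    using \<sigma>(2) that by (rule block_image_cong[OF part])
  then show "tr_blocks P V \<tau> \<pi> f \<in> extensional ((`) \<sigma> ` \<pi>)"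
    using tr_blocks_extensional[of P V \<tau> \<pi> f] by (simp cong: image_cong)
  fix B assume B: "B \<in> \<pi>"
  then have "B \<subseteq> V"
    using partition_onD1[OF part] by blast
  then have "tr P B \<tau> (f B) = tr P B \<sigma> (f B)"
    using f B \<sigma>(2) bij_betw_imp_inj_on[OF bij_betw_block[OF part \<tau> B]]
    by (intro tr_cong[OF P finite_partition_on(2)[OF part V]]) auto
  then show "tr_blocks P V \<tau> \<pi> f (\<sigma> ` B) = tr P B \<sigma> (f B)"
    by (simp add: im B tr_blocks_image[OF part \<tau>])
qed

lemma tr_subst_cong:
  assumes R: "is_species R" and P: "is_species P" and V: "finite V"
    and \<sigma>: "inj_on \<sigma> V" "\<forall>x\<in>V. \<sigma> x = \<tau> x" and s: "s \<in> str (sp_subst R P) V"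
  shows "tr (sp_subst R P) V \<sigma> s = tr (sp_subst R P) V \<tau> s"
proof -
  obtain \<pi> f r where seq: "s = (\<pi>, f, r)" and part: "partition_on V \<pi>"
    and f: "f \<in> (\<Pi>\<^sub>E B\<in>\<pi>. str P B)" and r: "r \<in> str R (blk ` \<pi>)"
    using s by (elim str_substE)
  note fin = finite_partition_on[OF part V]
  have im: "\<sigma> ` B = \<tau> ` B" if "B \<in> \<pi>" for B
    using \<sigma>(2) that by (intro block_image_cong[OF part]) auto
  have "tr_blocks P V \<sigma> \<pi> f = tr_blocks P V \<tau> \<pi> f"
    using \<sigma> by (intro tr_blocks_cong[OF P V part f]) auto
  moreover have "tr R (blk ` \<pi>) (\<lambda>x. blk (\<sigma> ` unblk x)) r =
      tr R (blk ` \<pi>) (\<lambda>x. blk (\<tau> ` unblk x)) r"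
    using bij_betw_imp_inj_on[OF bij_betw_blk_image[OF part V \<sigma>(1)]] fin im r
    by (intro tr_cong[OF R]) auto
  ultimately show ?thesis
    using im by (simp add: seq tr_subst_eq cong: image_cong)
qed

lemma tr_subst_id:
  assumes R: "is_species R" and P: "is_species P" and V: "finite V"
    and s: "s \<in> str (sp_subst R P) V"
  shows "tr (sp_subst R P) V id s = s"
proof -
  obtain \<pi> f r where seq: "s = (\<pi>, f, r)" and part: "partition_on V \<pi>"
    and f: "f \<in> (\<Pi>\<^sub>E B\<in>\<pi>. str P B)" and r: "r \<in> str R (blk ` \<pi>)"
    using s by (elim str_substE)
  note fin = finite_partition_on[OF part V]
  have "tr_blocks P V id \<pi> f = f"
    using f fin by (intro tr_blocks_eqI[OF part inj_on_id]) (auto simp: PiE_iff tr_ident[OF P])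
  moreover have "tr R (blk ` \<pi>) (\<lambda>x. blk (id ` unblk x)) r = r"
    using fin r by (intro tr_ident[OF R]) auto
  ultimately show ?thesis
    by (simp add: seq tr_subst_eq)
qed

lemma tr_subst_comp:
  assumes R: "is_species R" and P: "is_species P" and V: "finite V"
    and \<sigma>: "bij_betw \<sigma> V W" and \<tau>: "inj_on \<tau> W" and s: "s \<in> str (sp_subst R P) V"
  shows "tr (sp_subst R P) V (\<tau> \<circ> \<sigma>) s = tr (sp_subst R P) W \<tau> (tr (sp_subst R P) V \<sigma> s)"
proof -
  obtain \<pi> f r where seq: "s = (\<pi>, f, r)" and part: "partition_on V \<pi>"
    and f: "f \<in> (\<Pi>\<^sub>E B\<in>\<pi>. str P B)" and r: "r \<in> str R (blk ` \<pi>)"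
    using s by (elim str_substE)
  note fin = finite_partition_on[OF part V]
  have inj: "inj_on \<sigma> V" "inj_on (\<tau> \<circ> \<sigma>) V" and W: "\<sigma> ` V = W" "finite W"
    using \<sigma> \<tau> V by (auto simp: bij_betw_def intro: comp_inj_on)
  have part': "partition_on W ((`) \<sigma> ` \<pi>)"
    using partition_on_image[OF part inj(1)] by (simp add: W(1))
  have "tr_blocks P V (\<tau> \<circ> \<sigma>) \<pi> f (\<tau> ` \<sigma> ` B) = tr P (\<sigma> ` B) \<tau> (tr_blocks P V \<sigma> \<pi> f (\<sigma> ` B))"
    if B: "B \<in> \<pi>" for B
  proof -
    have "tr P (\<sigma> ` B) \<tau> (tr P B \<sigma> (f B)) = tr P B (\<tau> \<circ> \<sigma>) (f B)"
      using f B bij_betw_imp_inj_on[OF bij_betw_block[OF part' \<tau>]]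
      by (intro tr_tr[OF P fin(2) bij_betw_block[OF part inj(1)]]) auto
    then show ?thesis
      using tr_blocks_image[OF part inj(2) B]
      by (simp add: image_comp tr_blocks_image[OF part inj(1) B])
  qed
  then have "tr_blocks P W \<tau> ((`) \<sigma> ` \<pi>) (tr_blocks P V \<sigma> \<pi> f) = tr_blocks P V (\<tau> \<circ> \<sigma>) \<pi> f"
    using tr_blocks_extensional[of P V "\<tau> \<circ> \<sigma>" \<pi> f]
    by (intro tr_blocks_eqI[OF part' \<tau>]) (auto simp: image_image image_comp)
  moreover have "tr R (blk ` (`) \<sigma> ` \<pi>) (\<lambda>x. blk (\<tau> ` unblk x))
        (tr R (blk ` \<pi>) (\<lambda>x. blk (\<sigma> ` unblk x)) r) =
      tr R (blk ` \<pi>) (\<lambda>x. blk ((\<tau> \<circ> \<sigma>) ` unblk x)) r"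
    using fin r bij_betw_imp_inj_on[OF bij_betw_blk_image[OF part' W(2) \<tau>]]
    by (intro tr_tr[OF R _ bij_betw_blk_image[OF part V inj(1)]]) (auto simp: image_comp)
  ultimately show ?thesis
    by (simp add: seq tr_subst_eq image_image image_comp)
qed

lemma is_species_subst:
  assumes "is_species R" "is_species P"
  shows "is_species (sp_subst R P)"
  by (rule is_speciesI)
    (blast intro: finite_str_subst[OF assms] tr_subst_in[OF assms] tr_subst_cong[OF assms]
      tr_subst_id[OF assms] tr_subst_comp[OF assms])+


subsection \<open>The chain rule\<close>

text \<open>The chain rule with an arbitrary point \<open>x\<close> in place of the new point.\<close>

definition graft ::
    "('a, 's) species \<Rightarrow> ('a, 't) species \<Rightarrow> 'a label \<Rightarrow> 'a label set \<Rightarrow> 't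
     \<Rightarrow> ('a, 's, 't) subst_str \<Rightarrow> ('a, 's, 't) subst_str" where
  "graft R P x U p = (\<lambda>(\<pi>, f, r).
     (insert (insert x U) \<pi>, f(insert x U := repoint P U x p),
      repoint R (blk ` \<pi>) (blk (insert x U)) r))"

lemma graft_in:
  assumes R: "is_species R" and P: "is_species P" and fin: "finite V1" "finite V2"
    and disj: "V1 \<inter> V2 = {}" and x: "x \<notin> V1 \<union> V2"
    and p: "p \<in> str (deriv P) V1" and t: "t \<in> str (sp_subst (deriv R) P) V2"
  shows "graft R P x V1 p t \<in> str (sp_subst R P) (insert x (V1 \<union> V2))"
proof -
  obtain \<pi> f r where teq: "t = (\<pi>, f, r)" and part: "partition_on V2 \<pi>"
    and f: "f \<in> (\<Pi>\<^sub>E B\<in>\<pi>. str P B)" and r: "r \<in> str (deriv R) (blk ` \<pi>)"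
    using t by (elim str_substE)
  have "partition_on (insert x V1 \<union> V2) (insert (insert x V1) \<pi>)"
    using disj x by (intro partition_on_disjoint_Un[OF part]) auto
  moreover have "f(insert x V1 := repoint P V1 x p) \<in> (\<Pi>\<^sub>E B\<in>insert (insert x V1) \<pi>. str P B)"
    using f x repoint_in[OF P fin(1) _ p] by (auto simp: PiE_iff extensional_def)
  moreover have "repoint R (blk ` \<pi>) (blk (insert x V1)) r \<in> str R (blk ` insert (insert x V1) \<pi>)"
    using finite_partition_on(1)[OF part] blk_insert_notin_partition[OF part] fin x r
    by (simp add: repoint_in[OF R])
  ultimately show ?thesis
    by (simp add: graft_def teq in_str_subst)
qed

lemma tr_graft:
  assumes R: "is_species R" and P: "is_species P" and fin: "finite V1" "finite V2"
    and disj: "V1 \<inter> V2 = {}" and x: "x \<notin> V1 \<union> V2"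
    and p: "p \<in> str (deriv P) V1" and t: "t \<in> str (sp_subst (deriv R) P) V2"
    and \<sigma>: "bij_betw \<sigma> (V1 \<union> V2) W" and y: "y \<notin> W"
  shows "tr (sp_subst R P) (insert x (V1 \<union> V2)) (\<sigma>(x := y)) (graft R P x V1 p t) =
    graft R P y (\<sigma> ` V1) (tr (deriv P) V1 \<sigma> p) (tr (sp_subst (deriv R) P) V2 \<sigma> t)"
proof -
  obtain \<pi> f r where teq: "t = (\<pi>, f, r)" and part: "partition_on V2 \<pi>"
    and f: "f \<in> (\<Pi>\<^sub>E B\<in>\<pi>. str P B)" and r: "r \<in> str (deriv R) (blk ` \<pi>)"
    using t by (elim str_substE)
  let ?\<tau> = "\<sigma>(x := y)" and ?B = "insert x V1" and ?C = "insert y (\<sigma> ` V1)"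
  have B: "?B \<inter> V2 = {}" "?B \<noteq> {}"
    using disj x by auto
  have \<tau>: "inj_on ?\<tau> (?B \<union> V2)"
    using bij_betw_imp_inj_on[OF bij_betw_fun_upd[OF \<sigma> x y]] by simp
  have \<sigma>12: "inj_on \<sigma> V1" "inj_on \<sigma> V2" and y': "y \<notin> \<sigma> ` V1" "y \<notin> \<sigma> ` V2"
    using \<sigma> y by (auto simp: bij_betw_def inj_on_Un)
  have imB: "?\<tau> ` ?B = ?C"
    using x by auto
  have im: "?\<tau> ` B = \<sigma> ` B" if "B \<in> \<pi>" for B
    using that part x by (intro image_cong) (auto simp: partition_on_def)
  have "tr P ?B ?\<tau> (repoint P V1 x p) = repoint P (\<sigma> ` V1) y (tr (deriv P) V1 \<sigma> p)"
    using x y' by (intro tr_repoint[OF P fin(1) p inj_on_imp_bij_betw[OF \<sigma>12(1)]]) auto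
  moreover have "tr_blocks P V2 ?\<tau> \<pi> f = tr_blocks P V2 \<sigma> \<pi> f"
    using x inj_on_subset[OF \<tau>] by (intro tr_blocks_cong[OF P fin(2) part f]) auto
  ultimately have blocks: "tr_blocks P (?B \<union> V2) ?\<tau> (insert ?B \<pi>) (f(?B := repoint P V1 x p)) =
      (tr_blocks P V2 \<sigma> \<pi> f)(?C := repoint P (\<sigma> ` V1) y (tr (deriv P) V1 \<sigma> p))"
    by (simp only: tr_blocks_insert[OF part B \<tau>] imB)
  have inj: "inj_on ((`) ?\<tau>) (insert ?B \<pi>)"
    using \<tau> partition_onD1[OF part] by (intro inj_on_image) simp
  have "tr R (insert (blk ?B) (blk ` \<pi>)) (\<lambda>z. blk (?\<tau> ` unblk z)) (repoint R (blk ` \<pi>) (blk ?B) r) =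
      repoint R (blk ` (`) \<sigma> ` \<pi>) (blk ?C) (tr (deriv R) (blk ` \<pi>) (\<lambda>z. blk (\<sigma> ` unblk z)) r)"
    unfolding imB[symmetric]
    by (rule tr_repoint_blk[OF R _ _ insert_notin_partition[OF part] inj im[symmetric] r])
      (use fin finite_partition_on[OF part fin(2)] x in auto)
  moreover have "(`) ?\<tau> ` insert ?B \<pi> = insert ?C ((`) \<sigma> ` \<pi>)"
    using im imB by (simp cong: image_cong)
  ultimately show ?thesis
    using blocks by (simp add: teq graft_def tr_subst_eq)
qed

lemma repoint_graft:
  assumes R: "is_species R" and P: "is_species P" and fin: "finite V1" "finite V2"
    and disj: "V1 \<inter> V2 = {}" and x: "x \<notin> V1 \<union> V2"
    and p: "p \<in> str (deriv P) V1" and t: "t \<in> str (sp_subst (deriv R) P) V2"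
  shows "repoint (sp_subst R P) (V1 \<union> V2) x (graft R P (star (V1 \<union> V2)) V1 p t) =
    graft R P x V1 p t"
proof -
  have "repoint (sp_subst R P) (V1 \<union> V2) x (graft R P (star (V1 \<union> V2)) V1 p t) =
      graft R P x (id ` V1) (tr (deriv P) V1 id p) (tr (sp_subst (deriv R) P) V2 id t)"
    unfolding repoint_def plus_star_def
    using fin x star_notin[of "V1 \<union> V2"]
    by (intro tr_graft[OF R P fin disj _ p t bij_betw_id]) simp_all
  then show ?thesis
    using fin p t by (simp add: tr_ident is_species_deriv is_species_subst R P)
qed

lemma subst_mor_graft:
  assumes \<phi>: "is_mor R R' \<phi>" and \<psi>: "is_mor P P' \<psi>" and fin: "finite V1" "finite V2"
    and x: "x \<notin> V1 \<union> V2" and p: "p \<in> str (deriv P) V1" and t: "t \<in> str (sp_subst (deriv R) P) V2"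
  shows "subst_mor \<phi> \<psi> V (graft R P x V1 p t) =
    graft R' P' x V1 (deriv_mor \<psi> V1 p) (subst_mor (deriv_mor \<phi>) \<psi> V2 t)"
proof -
  obtain \<pi> f r where teq: "t = (\<pi>, f, r)" and part: "partition_on V2 \<pi>"
    and r: "r \<in> str (deriv R) (blk ` \<pi>)"
    using t by (elim str_substE)
  have "\<psi> (insert x V1) (repoint P V1 x p) = repoint P' V1 x (deriv_mor \<psi> V1 p)"
    using x by (intro mor_repoint[OF \<psi> fin(1) _ p]) simp
  moreover have "\<phi> (insert (blk (insert x V1)) (blk ` \<pi>))
        (repoint R (blk ` \<pi>) (blk (insert x V1)) r) =
      repoint R' (blk ` \<pi>) (blk (insert x V1)) (deriv_mor \<phi> (blk ` \<pi>) r)"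
    using finite_partition_on(1)[OF part] blk_insert_notin_partition[OF part] fin x r
    by (intro mor_repoint[OF \<phi>]) simp_all
  ultimately show ?thesis
    by (auto simp: teq graft_def subst_mor_def fun_eq_iff)
qed

definition chain_swap ::
    "('a, 's) species \<Rightarrow> ('a, 't) species
     \<Rightarrow> ('a, ('a, 't, ('a, 's, 't) subst_str) prod_str, ('a, 's, 't) subst_str) mor" where
  "chain_swap R P = chain_rule R P \<circ>\<^sub>s prod_swap"

lemma chain_swap_eq_graft:
  assumes V: "finite V" and V2: "V2 \<subseteq> V" and t: "t \<in> str (sp_subst R' P') V2"
  shows "chain_swap R P V ((V1, V2), (p, t)) = graft R P (star V) V1 p t"
proof -
  obtain \<pi> f r where teq: "t = (\<pi>, f, r)" and part: "partition_on V2 \<pi>"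
    and f: "f \<in> (\<Pi>\<^sub>E B\<in>\<pi>. str P' B)"
    using t by (elim str_substE)
  have "insert (star V) V1 \<notin> \<pi>"
    using V V2 star_notin by (intro insert_notin_partition[OF part]) auto
  then show ?thesis
    using f by (auto simp: teq chain_swap_def mor_comp_def prod_swap_def chain_rule_def graft_def
        Let_def repoint_def PiE_iff extensional_def fun_eq_iff)
qed

lemma maps_str_chain_swap:
  assumes R: "is_species R" and P: "is_species P"
  shows "maps_str (sp_prod (deriv P) (sp_subst (deriv R) P)) (deriv (sp_subst R P))
    (chain_swap R P)"
proof (rule maps_strI)
  fix V s assume V: "finite V" and "s \<in> str (sp_prod (deriv P) (sp_subst (deriv R) P)) V"
  then obtain V1 V2 p t where s: "s = ((V1, V2), (p, t))" "V = V1 \<union> V2" "V1 \<inter> V2 = {}"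
    "p \<in> str (deriv P) V1" "t \<in> str (sp_subst (deriv R) P) V2" by (elim str_prodE)
  then show "chain_swap R P V s \<in> str (deriv (sp_subst R P)) V"
    using graft_in[OF R P _ _ s(3) _ s(4,5)] chain_swap_eq_graft[OF V _ s(5)] star_notin[OF V] V
    by (simp add: str_deriv plus_star_def)
qed

lemma is_mor_chain_swap:
  assumes R: "is_species R" and P: "is_species P"
  shows "is_mor (sp_prod (deriv P) (sp_subst (deriv R) P)) (deriv (sp_subst R P))
    (chain_swap R P)"
proof (rule is_morI[OF maps_str_chain_swap[OF R P]])
  fix V W :: "'a label set" and \<sigma> s
  assume V: "finite V" and \<sigma>: "bij_betw \<sigma> V W"
    and "s \<in> str (sp_prod (deriv P) (sp_subst (deriv R) P)) V"
  then obtain V1 V2 p t where s: "s = ((V1, V2), (p, t))" "V = V1 \<union> V2" "V1 \<inter> V2 = {}"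
    and p: "p \<in> str (deriv P) V1" and t: "t \<in> str (sp_subst (deriv R) P) V2" by (elim str_prodE)
  have fin: "finite V1" "finite V2" and W: "finite W" "\<sigma> ` V2 \<subseteq> W"
    using V \<sigma> s(2) bij_betw_finite[OF \<sigma>] by (auto simp: bij_betw_def)
  have "bij_betw \<sigma> V2 (\<sigma> ` V2)"
    using \<sigma> s(2) by (auto simp: bij_betw_def inj_on_Un)
  then have t': "tr (sp_subst (deriv R) P) V2 \<sigma> t \<in> str (sp_subst (deriv R) P) (\<sigma> ` V2)"
    using fin t by (intro tr_in is_species_subst is_species_deriv R P)
  have "chain_swap R P W (tr (sp_prod (deriv P) (sp_subst (deriv R) P)) V \<sigma> s) =
      graft R P (star W) (\<sigma> ` V1) (tr (deriv P) V1 \<sigma> p) (tr (sp_subst (deriv R) P) V2 \<sigma> t)"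
    using chain_swap_eq_graft[OF W t'] by (simp add: sp_prod_def s(1))
  also have "\<dots> = tr (sp_subst R P) (insert (star V) (V1 \<union> V2)) (\<sigma>(star V := star W))
      (graft R P (star V) V1 p t)"
    using \<sigma> star_notin[OF V] star_notin[OF W(1)]
    by (intro tr_graft[OF R P fin s(3) _ p t, symmetric]) (simp_all add: s(2))
  also have "\<dots> = tr (deriv (sp_subst R P)) V \<sigma> (chain_swap R P V s)"
    unfolding tr_deriv[OF \<sigma>] using chain_swap_eq_graft[OF V _ t] by (simp add: s plus_star_def)
  finally show "chain_swap R P W (tr (sp_prod (deriv P) (sp_subst (deriv R) P)) V \<sigma> s) =
      tr (deriv (sp_subst R P)) V \<sigma> (chain_swap R P V s)" .
qed

lemma chain_swap_natural:
  assumes \<phi>: "is_mor R R' \<phi>" and \<psi>: "is_mor P P' \<psi>"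
  shows "mor_eq (sp_prod (deriv P) (sp_subst (deriv R) P))
    (chain_swap R' P' \<circ>\<^sub>s prod_mor (deriv_mor \<psi>) (subst_mor (deriv_mor \<phi>) \<psi>))
    (deriv_mor (subst_mor \<phi> \<psi>) \<circ>\<^sub>s chain_swap R P)" (is "mor_eq _ ?lhs ?rhs")
  unfolding mor_eq_def
proof (intro allI impI ballI)
  fix V s assume V: "finite V" and "s \<in> str (sp_prod (deriv P) (sp_subst (deriv R) P)) V"
  then obtain V1 V2 p t where s: "s = ((V1, V2), (p, t))" "V = V1 \<union> V2"
    and p: "p \<in> str (deriv P) V1" and t: "t \<in> str (sp_subst (deriv R) P) V2" by (elim str_prodE)
  have fin: "finite V1" "finite V2" and V2: "V2 \<subseteq> V" and star: "star V \<notin> V1 \<union> V2"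
    using V s(2) star_notin[OF V] by auto
  have "maps_str (sp_subst (deriv R) P) (sp_subst (deriv R') P') (subst_mor (deriv_mor \<phi>) \<psi>)"
    using \<phi> \<psi> by (intro maps_str_subst_mor maps_str_deriv_mor is_mor_maps_str)
  then have t': "subst_mor (deriv_mor \<phi>) \<psi> V2 t \<in> str (sp_subst (deriv R') P') V2"
    using fin(2) t by (rule maps_strD)
  have "?lhs V s = graft R' P' (star V) V1 (deriv_mor \<psi> V1 p) (subst_mor (deriv_mor \<phi>) \<psi> V2 t)"
    using chain_swap_eq_graft[OF V V2 t'] by (simp add: s(1) mor_comp_def prod_mor_def)
  also have "\<dots> = subst_mor \<phi> \<psi> (plus_star V) (graft R P (star V) V1 p t)"
    by (rule subst_mor_graft[OF \<phi> \<psi> fin star p t, symmetric])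
  also have "\<dots> = ?rhs V s"
    using chain_swap_eq_graft[OF V V2 t] by (simp add: s(1) mor_comp_def deriv_mor_def)
  finally show "?lhs V s = ?rhs V s" .
qed

lemma chain_swap_natural_inner:
  assumes "is_mor P P' \<psi>"
  shows "mor_eq (sp_prod (deriv P) (sp_subst (deriv R) P))
    (chain_swap R P' \<circ>\<^sub>s prod_mor (deriv_mor \<psi>) (subst_mor mor_id \<psi>))
    (deriv_mor (subst_mor mor_id \<psi>) \<circ>\<^sub>s chain_swap R P)"
  using chain_swap_natural[OF is_mor_id[of R] assms] by simp

lemma chain_swap_natural_outer:
  assumes "is_mor R R' \<phi>"
  shows "mor_eq (sp_prod (deriv P) (sp_subst (deriv R) P))
    (chain_swap R' P \<circ>\<^sub>s prod_mor mor_id (subst_mor (deriv_mor \<phi>) mor_id))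
    (deriv_mor (subst_mor \<phi> mor_id) \<circ>\<^sub>s chain_swap R P)"
  using chain_swap_natural[OF assms is_mor_id[of P]] by simp


subsection \<open>The associativity isomorphisms\<close>

lemma restrict_blocks_in_str:
  assumes part: "partition_on V \<pi>" and V: "finite V" and f: "f \<in> (\<Pi>\<^sub>E B\<in>\<pi>. str P B)"
    and K: "K \<subseteq> blk ` \<pi>" and a: "a \<in> str M K"
  shows "(unblk ` K, restrict f (unblk ` K), a) \<in> str (sp_subst M P) (flat K)"
proof -
  have "restrict f (unblk ` K) \<in> (\<Pi>\<^sub>E B\<in>unblk ` K. str P B)"
    using f unblk_image_subset[OF part V K] by (auto simp: PiE_iff)
  then show ?thesis
    using partition_on_unblk_image[OF part V K] blk_image_unblk_image[OF part V K] a
    by (simp add: in_str_subst)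
qed

definition regroup ::
    "'a label set set \<Rightarrow> ('a label set \<Rightarrow> 't) \<Rightarrow> 'a label set set \<Rightarrow> ('a label set \<Rightarrow> 's)
     \<Rightarrow> 'a label set \<Rightarrow> ('a, 's, 't) subst_str" where
  "regroup \<pi> f \<kappa> g =
     (\<lambda>D\<in>flat ` \<kappa>. let \<pi>D = {B \<in> \<pi>. B \<subseteq> D} in (\<pi>D, restrict f \<pi>D, g (blk ` \<pi>D)))"

lemma subst_assoc_eq:
  "subst_assoc A V (\<pi>, f, (\<kappa>, g, a)) =
    (flat ` \<kappa>, regroup \<pi> f \<kappa> g, tr A (blk ` \<kappa>) (\<lambda>x. blk (flat (unblk x))) a)"
  by (simp add: subst_assoc_def regroup_def Let_def)

lemma regroup_extensional: "regroup \<pi> f \<kappa> g \<in> extensional (flat ` \<kappa>)"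
  by (simp add: regroup_def)

lemma regroup_flat:
  assumes part: "partition_on V \<pi>" and V: "finite V" and K: "K \<subseteq> blk ` \<pi>" "K \<in> \<kappa>"
  shows "regroup \<pi> f \<kappa> g (flat K) = (unblk ` K, restrict f (unblk ` K), g K)"
  using K(2) blocks_of_flat[OF part V K(1)] blk_image_unblk_image[OF part V K(1)]
  by (simp add: regroup_def)

lemma bij_betw_blk_flat:
  assumes part: "partition_on V \<pi>" and V: "finite V" and \<kappa>: "partition_on (blk ` \<pi>) \<kappa>"
  shows "bij_betw (\<lambda>x. blk (flat (unblk x))) (blk ` \<kappa>) (blk ` flat ` \<kappa>)"
proof (rule bij_betw_blk_map)
  show "inj_on flat \<kappa>"
    using \<kappa> by (intro inj_on_subset[OF inj_on_flat[OF part V]]) (auto simp: partition_on_def)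
  show "finite L" if "L \<in> \<kappa>" for L
    using that finite_partition_on[OF \<kappa>] finite_partition_on(1)[OF part V] by simp
  show "finite (flat L)" if "L \<in> \<kappa>" for L
    using that V finite_partition_on(2)[OF partition_on_flat[OF part V \<kappa>]] by simp
qed

lemma maps_str_subst_assoc:
  assumes A: "is_species A"
  shows "maps_str (sp_subst (sp_subst A B) C) (sp_subst A (sp_subst B C)) (subst_assoc A)"
proof (rule maps_strI)
  fix V s assume V: "finite V" and "s \<in> str (sp_subst (sp_subst A B) C) V"
  then obtain \<pi> f \<kappa> g a where s: "s = (\<pi>, f, (\<kappa>, g, a))" and part: "partition_on V \<pi>"
    and f: "f \<in> (\<Pi>\<^sub>E D\<in>\<pi>. str C D)" and \<kappa>: "partition_on (blk ` \<pi>) \<kappa>"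
    and g: "g \<in> (\<Pi>\<^sub>E L\<in>\<kappa>. str B L)" and a: "a \<in> str A (blk ` \<kappa>)"
    by (elim str_substE) (metis str_substE)
  have "regroup \<pi> f \<kappa> g (flat L) \<in> str (sp_subst B C) (flat L)" if L: "L \<in> \<kappa>" for L
  proof -
    have "L \<subseteq> blk ` \<pi>"
      using L \<kappa> by (auto simp: partition_on_def)
    then show ?thesis
      using L g restrict_blocks_in_str[OF part V f, of L "g L"]
      by (simp add: regroup_flat[OF part V] PiE_iff)
  qed
  then have "regroup \<pi> f \<kappa> g \<in> (\<Pi>\<^sub>E D\<in>flat ` \<kappa>. str (sp_subst B C) D)"
    using regroup_extensional by (auto simp: PiE_iff)
  moreover have "finite \<kappa>"
    using finite_partition_on(1)[OF \<kappa>] finite_partition_on(1)[OF part V] by simp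
  then have "tr A (blk ` \<kappa>) (\<lambda>x. blk (flat (unblk x))) a \<in> str A (blk ` flat ` \<kappa>)"
    using a by (intro tr_in[OF A _ bij_betw_blk_flat[OF part V \<kappa>]]) simp_all
  ultimately show "subst_assoc A V s \<in> str (sp_subst A (sp_subst B C)) V"
    using partition_on_flat[OF part V \<kappa>] by (simp add: s subst_assoc_eq in_str_subst)
qed

lemma regroup_restrict:
  assumes part: "partition_on V \<pi>" "finite V" and K: "K \<subseteq> blk ` \<pi>" "L \<subseteq> K" and L: "L \<in> \<kappa>" "\<kappa> \<subseteq> \<kappa>'"
    and f: "\<And>B. B \<in> unblk ` L \<Longrightarrow> f' B = f B" and g: "g' L = g L"
  shows "regroup \<pi> f' \<kappa>' g' (flat L) = regroup (unblk ` K) (restrict f (unblk ` K)) \<kappa> g (flat L)"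
proof -
  have "restrict f' (unblk ` L) = restrict (restrict f (unblk ` K)) (unblk ` L)"
    using f K(2) by (auto simp: fun_eq_iff restrict_def)
  moreover have "regroup \<pi> f' \<kappa>' g' (flat L) = (unblk ` L, restrict f' (unblk ` L), g' L)"
    using K L by (intro regroup_flat[OF part]) auto
  moreover have "regroup (unblk ` K) (restrict f (unblk ` K)) \<kappa> g (flat L) =
      (unblk ` L, restrict (restrict f (unblk ` K)) (unblk ` L), g L)"
    using K(2) L blk_image_unblk_image[OF part K(1)]
    by (intro regroup_flat[OF partition_on_unblk_image[OF part K(1)] finite_flat[OF part K(1)]])
      auto
  ultimately show ?thesis
    by (simp add: g)
qed

lemma regroup_insert:
  assumes part: "partition_on V (insert B \<pi>)" "finite V" and B: "B \<notin> \<pi>"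
    and K: "blk ` \<pi> = K1 \<union> K2" and \<kappa>: "partition_on K2 \<kappa>" and L: "L = insert (blk B) K1"
  shows "regroup (insert B \<pi>) (f(B := c)) (insert L \<kappa>) (g(L := d)) =
    (regroup (unblk ` K2) (restrict f (unblk ` K2)) \<kappa> g)
      (flat L := (unblk ` L, (restrict f (unblk ` K1))(B := c), d))" (is "?lhs = ?rhs")
proof (rule extensionalityI)
  have sub: "L \<subseteq> blk ` insert B \<pi>" "K2 \<subseteq> blk ` insert B \<pi>" "\<And>M. M \<in> \<kappa> \<Longrightarrow> M \<subseteq> K2"
    using \<kappa> by (auto simp: K L partition_on_def)
  have finB: "finite C" if "C \<in> insert B \<pi>" for C
    using finite_partition_on(2)[OF part that] .
  have "unblk ` (K1 \<union> K2) = \<pi>"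
    using bij_betw_unblk[of \<pi>] finB by (simp add: K bij_betw_def)
  then have unblk: "unblk ` L = insert B (unblk ` K1)" "B \<notin> unblk ` K1" "B \<notin> unblk ` K2"
    using finB B by (auto simp: L image_Un)
  have "blk B \<notin> blk ` \<pi>"
    using finB B by (simp add: blk_mem_image_iff)
  then have L\<kappa>: "L \<notin> \<kappa>"
    unfolding K L by (intro insert_notin_partition[OF \<kappa>]) simp
  show "?lhs \<in> extensional (flat ` insert L \<kappa>)"
    by (rule regroup_extensional)
  show "?rhs \<in> extensional (flat ` insert L \<kappa>)"
    using regroup_extensional[of "unblk ` K2" _ \<kappa> g] by (auto simp: extensional_def)
  fix D assume "D \<in> flat ` insert L \<kappa>"
  then consider (new) "D = flat L" | (old) M where "M \<in> \<kappa>" "D = flat M" by blast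
  then show "?lhs D = ?rhs D"
  proof cases
    case new
    have "restrict (f(B := c)) (unblk ` L) = (restrict f (unblk ` K1))(B := c)"
      using unblk by (auto simp: fun_eq_iff restrict_def)
    then show ?thesis
      using regroup_flat[OF part sub(1), of "insert L \<kappa>" "f(B := c)" "g(L := d)"] by (simp add: new)
  next
    case old
    have M: "M \<subseteq> blk ` insert B \<pi>"
      using sub(3)[OF old(1)] sub(2) by (rule subset_trans)
    have "flat M \<noteq> flat L"
      using inj_onD[OF inj_on_flat[OF part] _ PowI[OF M] PowI[OF sub(1)]] old(1) L\<kappa> by blast
    moreover have "?lhs (flat M) = regroup (unblk ` K2) (restrict f (unblk ` K2)) \<kappa> g (flat M)"
      using old(1) sub(3) unblk(3) L\<kappa> by (intro regroup_restrict[OF part sub(2)]) auto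
    ultimately show ?thesis
      by (simp add: old(2))
  qed
qed

lemma subst_assoc_insert:
  assumes A: "is_species A" and part: "partition_on V (insert B \<pi>)" "finite V" and B: "B \<notin> \<pi>"
    and K: "blk ` \<pi> = K1 \<union> K2" and \<kappa>: "partition_on K2 \<kappa>" and a: "a \<in> str (deriv A) (blk ` \<kappa>)"
    and L: "L = insert (blk B) K1"
  shows "subst_assoc A U
      (insert B \<pi>, f(B := c), (insert L \<kappa>, g(L := d), repoint A (blk ` \<kappa>) (blk L) a)) =
    (insert (flat L) (flat ` \<kappa>),
     (regroup (unblk ` K2) (restrict f (unblk ` K2)) \<kappa> g)
       (flat L := (unblk ` L, (restrict f (unblk ` K1))(B := c), d)),
     repoint A (blk ` flat ` \<kappa>) (blk (flat L))
       (tr (deriv A) (blk ` \<kappa>) (\<lambda>x. blk (flat (unblk x))) a))"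
proof -
  have "finite (K1 \<union> K2)"
    unfolding K[symmetric] using finite_partition_on(1)[OF part] by simp
  then have finK2: "finite K2"
    by simp
  have sub: "M \<subseteq> blk ` insert B \<pi>" if "M \<in> insert L \<kappa>" for M
    using that \<kappa> by (auto simp: K L partition_on_def)
  have "blk B \<notin> blk ` \<pi>"
    using B finite_partition_on(2)[OF part] by (simp add: blk_mem_image_iff)
  then have L\<kappa>: "L \<notin> \<kappa>"
    unfolding K L by (intro insert_notin_partition[OF \<kappa>]) simp
  have inj: "inj_on flat (insert L \<kappa>)"
    by (rule inj_on_subset[OF inj_on_flat[OF part]], rule subsetI, rule PowI, rule sub)
  have fin: "finite M \<and> finite (flat M)" if "M \<in> insert L \<kappa>" for M
    using finite_flat[OF part sub[OF that]] finite_subset[OF sub[OF that]]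
      finite_partition_on(1)[OF part] by simp
  note tr_repoint_blk[OF A finite_partition_on(1)[OF \<kappa> finK2] fin L\<kappa> inj refl a]
  then show ?thesis
    by (simp only: subst_assoc_eq regroup_insert[OF part B K \<kappa> L] image_insert)
qed

definition prod_subst_assoc ::
    "('a, 's) species \<Rightarrow>
     ('a, ('a, 'm, ('a, ('a, 'n, ('a, 's, 't) subst_str) prod_str, 'u) subst_str) prod_str,
      ('a, ('a, 'm, ('a, 'n, 'u) subst_str) prod_str, ('a, 's, ('a, 't, 'u) subst_str) subst_str)
        prod_str) mor" where
  "prod_subst_assoc A =
     prod_assoc \<circ>\<^sub>s prod_mor mor_id (prod_mor mor_id (subst_assoc A))
       \<circ>\<^sub>s prod_mor mor_id subst_distrib"

lemma prod_subst_assoc_eq: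
  "prod_subst_assoc A V ((V1, W), (m, (\<pi>, f, ((K1, K2), (n, t))))) =
    ((V1 \<union> flat K1, flat K2),
     (((V1, flat K1), (m, (unblk ` K1, restrict f (unblk ` K1), n))),
      subst_assoc A (flat K2) (unblk ` K2, restrict f (unblk ` K2), t)))"
  by (simp add: prod_subst_assoc_def mor_comp_def prod_mor_def prod_assoc_def subst_distrib_def
      mor_id_def Let_def)

lemma str_prod_subst_prodE:
  assumes "s \<in> str (sp_prod M (sp_subst (sp_prod N Q) C)) V"
  obtains V1 W m \<pi> f K1 K2 n t where "s = ((V1, W), (m, (\<pi>, f, ((K1, K2), (n, t)))))"
    "V = V1 \<union> W" "V1 \<inter> W = {}" "m \<in> str M V1" "partition_on W \<pi>" "f \<in> (\<Pi>\<^sub>E B\<in>\<pi>. str C B)"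
    "blk ` \<pi> = K1 \<union> K2" "K1 \<inter> K2 = {}" "n \<in> str N K1" "t \<in> str Q K2"
  using assms by (elim str_prodE str_substE) (metis str_prodE)

lemma maps_str_prod_subst_assoc:
  assumes A: "is_species A"
  shows "maps_str (sp_prod M (sp_subst (sp_prod N (sp_subst A B)) C))
    (sp_prod (sp_prod M (sp_subst N C)) (sp_subst A (sp_subst B C))) (prod_subst_assoc A)"
proof (rule maps_strI)
  fix V s assume V: "finite V" and "s \<in> str (sp_prod M (sp_subst (sp_prod N (sp_subst A B)) C)) V"
  then obtain V1 W m \<pi> f K1 K2 n t where s: "s = ((V1, W), (m, (\<pi>, f, ((K1, K2), (n, t)))))"
    and VW: "V = V1 \<union> W" "V1 \<inter> W = {}" and m: "m \<in> str M V1" and part: "partition_on W \<pi>"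
    and f: "f \<in> (\<Pi>\<^sub>E B\<in>\<pi>. str C B)" and K: "blk ` \<pi> = K1 \<union> K2" "K1 \<inter> K2 = {}"
    and n: "n \<in> str N K1" and t: "t \<in> str (sp_subst A B) K2"
    by (elim str_prod_subst_prodE)
  have W: "finite W" using V VW by simp
  have flat: "flat K1 \<union> flat K2 = W" "flat K1 \<inter> flat K2 = {}"
    using flat_blk_image[OF part W] flat_disjoint[OF part W _ _ K(2)] by (auto simp: K(1))
  have "(unblk ` K1, restrict f (unblk ` K1), n) \<in> str (sp_subst N C) (flat K1)"
    using restrict_blocks_in_str[OF part W f _ n] K by simp
  moreover have "(unblk ` K2, restrict f (unblk ` K2), t)
      \<in> str (sp_subst (sp_subst A B) C) (flat K2)"
    using restrict_blocks_in_str[OF part W f _ t] K by simp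
  then have "subst_assoc A (flat K2) (unblk ` K2, restrict f (unblk ` K2), t)
      \<in> str (sp_subst A (sp_subst B C)) (flat K2)"
    using W flat by (intro maps_strD[OF maps_str_subst_assoc[OF A]]) auto
  ultimately show "prod_subst_assoc A V s
      \<in> str (sp_prod (sp_prod M (sp_subst N C)) (sp_subst A (sp_subst B C))) V"
    using m VW flat unfolding s prod_subst_assoc_eq in_str_prod by blast
qed


subsection \<open>Coherence of the chain rule\<close>

lemma subst_assoc_graft:
  assumes A: "is_species A" and B: "is_species B" and C: "is_species C"
    and fin: "finite V1" "finite W" and disj: "V1 \<inter> W = {}" and x: "x \<notin> V1 \<union> W"
    and m: "m \<in> str (deriv C) V1" and part: "partition_on W \<pi>" and f: "f \<in> (\<Pi>\<^sub>E B\<in>\<pi>. str C B)"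
    and K: "blk ` \<pi> = K1 \<union> K2" "K1 \<inter> K2 = {}"
    and a: "a \<in> str (deriv B) K1" and t: "t \<in> str (sp_subst (deriv A) B) K2"
  shows "subst_assoc A V (graft (sp_subst A B) C x V1 m (\<pi>, f, graft A B (star (blk ` \<pi>)) K1 a t)) =
    graft A (sp_subst B C) x (V1 \<union> flat K1)
      (graft B C (star (V1 \<union> flat K1)) V1 m (unblk ` K1, restrict f (unblk ` K1), a))
      (subst_assoc (deriv A) U (unblk ` K2, restrict f (unblk ` K2), t))"
proof -
  obtain \<kappa> g b where teq: "t = (\<kappa>, g, b)" and \<kappa>: "partition_on K2 \<kappa>"
    and b: "b \<in> str (deriv A) (blk ` \<kappa>)"
    using t by (elim str_substE)
  let ?B = "insert x V1" and ?L = "insert (blk (insert x V1)) K1"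
  have part_B: "partition_on (?B \<union> W) (insert ?B \<pi>)" "finite (?B \<union> W)" "?B \<notin> \<pi>"
    using disj x fin partition_on_disjoint_Un[OF part, of ?B] insert_notin_partition[OF part]
    by auto
  have sub: "K1 \<subseteq> blk ` \<pi>"
    by (simp add: K(1))
  have "finite (K1 \<union> K2)"
    unfolding K(1)[symmetric] using finite_partition_on(1)[OF part fin(2)] by simp
  then have finK: "finite K1" "finite K2"
    by simp_all
  have "blk ?B \<notin> K1 \<union> K2"
    using blk_insert_notin_partition[OF part fin(2,1)] x by (simp add: K(1))
  then have inner: "repoint (sp_subst A B) (blk ` \<pi>) (blk ?B) (graft A B (star (blk ` \<pi>)) K1 a t) =
      graft A B (blk ?B) K1 a t"
    unfolding K(1) by (intro repoint_graft[OF A B finK K(2) _ a t])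
  have outer: "repoint (sp_subst B C) (V1 \<union> flat K1) x
      (graft B C (star (V1 \<union> flat K1)) V1 m (unblk ` K1, restrict f (unblk ` K1), a)) =
      graft B C x V1 m (unblk ` K1, restrict f (unblk ` K1), a)"
    using flat_subset[OF part fin(2) sub] disj x
    by (intro repoint_graft[OF B C fin(1) finite_flat[OF part fin(2) sub] _ _ m]
        restrict_blocks_in_str[OF part fin(2) f sub a]) auto
  have "flat ?L = insert x (V1 \<union> flat K1)" "unblk ` ?L = insert ?B (unblk ` K1)"
    using fin by simp_all
  then show ?thesis
    using inner outer
      subst_assoc_insert[OF A part_B K(1) \<kappa> b refl,
        of V f "repoint C V1 x m" g "repoint B K1 (blk ?B) a"]
    by (simp add: graft_def[of "sp_subst A B"] graft_def[of A] graft_def[of B C x] subst_assoc_eq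
        teq blk_image_unblk_image[OF part fin(2) sub])
qed

lemma chain_swap_subst_eq_graft:
  assumes A: "is_species A" and B: "is_species B" and V: "finite V" "W \<subseteq> V"
    and part: "partition_on W \<pi>" and f: "f \<in> (\<Pi>\<^sub>E B\<in>\<pi>. str C B)"
    and K: "blk ` \<pi> = K1 \<union> K2" "K1 \<inter> K2 = {}"
    and b: "b \<in> str (deriv B) K1" and t: "t \<in> str (sp_subst (deriv A) B) K2"
  shows "(chain_swap (sp_subst A B) C \<circ>\<^sub>s prod_mor mor_id (subst_mor (chain_swap A B) mor_id)) V
      ((V1, W), (m, (\<pi>, f, ((K1, K2), (b, t))))) =
    graft (sp_subst A B) C (star V) V1 m (\<pi>, f, graft A B (star (blk ` \<pi>)) K1 b t)"
proof -
  let ?c = "chain_swap A B (blk ` \<pi>) ((K1, K2), (b, t))"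
  have fin: "finite (blk ` \<pi>)"
    using finite_partition_on(1)[OF part finite_subset[OF V(2,1)]] by simp
  have "?c \<in> str (deriv (sp_subst A B)) (blk ` \<pi>)"
    using b t K by (intro maps_strD[OF maps_str_chain_swap[OF A B] fin]) (simp add: in_str_prod)
  then have c: "(\<pi>, f, ?c) \<in> str (sp_subst (deriv (sp_subst A B)) C) W"
    using part f by (simp add: in_str_subst)
  have "?c = graft A B (star (blk ` \<pi>)) K1 b t"
    using K(1) by (intro chain_swap_eq_graft[OF fin _ t]) simp
  then show ?thesis
    using chain_swap_eq_graft[OF V c] f
    by (simp add: mor_comp_def prod_mor_def subst_mor_def mor_id_def PiE_restrict)
qed

lemma chain_swap_prod_eq_graft:
  assumes A: "is_species A" and V: "finite V"
    and s: "((V1, W), (m, (\<pi>, f, ((K1, K2), (b, t)))))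
      \<in> str (sp_prod (deriv C) (sp_subst (sp_prod (deriv B) (sp_subst (deriv A) B)) C)) V"
    (is "?s \<in> _")
  shows "(chain_swap A (sp_subst B C) \<circ>\<^sub>s prod_mor (chain_swap B C) mor_id
      \<circ>\<^sub>s prod_subst_assoc (deriv A)) V ?s =
    graft A (sp_subst B C) (star V) (V1 \<union> flat K1)
      (graft B C (star (V1 \<union> flat K1)) V1 m (unblk ` K1, restrict f (unblk ` K1), b))
      (subst_assoc (deriv A) (flat K2) (unblk ` K2, restrict f (unblk ` K2), t))"
proof -
  let ?U = "V1 \<union> flat K1" and ?t1 = "(unblk ` K1, restrict f (unblk ` K1), b)"
    and ?t2 = "subst_assoc (deriv A) (flat K2) (unblk ` K2, restrict f (unblk ` K2), t)"
  have "prod_subst_assoc (deriv A) V ?s \<in> str (sp_prod (sp_prod (deriv C) (sp_subst (deriv B) C))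
      (sp_subst (deriv A) (sp_subst B C))) V"
    by (rule maps_strD[OF maps_str_prod_subst_assoc[OF is_species_deriv[OF A]] V s])
  then have U: "?U \<union> flat K2 = V" and t1: "?t1 \<in> str (sp_subst (deriv B) C) (flat K1)"
    and t2: "?t2 \<in> str (sp_subst (deriv A) (sp_subst B C)) (flat K2)"
    unfolding prod_subst_assoc_eq in_str_prod by - (elim conjE, assumption)+
  have sub: "?U \<subseteq> V" "flat K2 \<subseteq> V"
    unfolding U[symmetric] by (rule Un_upper1, rule Un_upper2)
  have "chain_swap B C ?U ((V1, flat K1), (m, ?t1)) = graft B C (star ?U) V1 m ?t1"
    by (rule chain_swap_eq_graft[OF finite_subset[OF sub(1) V] Un_upper2 t1])
  then show ?thesis
    using chain_swap_eq_graft[OF V sub(2) t2]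
    unfolding mor_comp_def prod_subst_assoc_eq by (simp add: prod_mor_def mor_id_def)
qed

lemma chain_swap_assoc:
  assumes A: "is_species A" and B: "is_species B" and C: "is_species C"
  shows "mor_eq (sp_prod (deriv C) (sp_subst (sp_prod (deriv B) (sp_subst (deriv A) B)) C))
    (chain_swap A (sp_subst B C) \<circ>\<^sub>s prod_mor (chain_swap B C) mor_id
      \<circ>\<^sub>s prod_subst_assoc (deriv A))
    (deriv_mor (subst_assoc A) \<circ>\<^sub>s (chain_swap (sp_subst A B) C
      \<circ>\<^sub>s prod_mor mor_id (subst_mor (chain_swap A B) mor_id)))" (is "mor_eq ?S ?lhs (_ \<circ>\<^sub>s ?rhs)")
  unfolding mor_eq_def
proof (intro allI impI ballI)
  fix V s assume V: "finite V" and S: "s \<in> str ?S V"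
  then obtain V1 W m \<pi> f K1 K2 b t where s: "s = ((V1, W), (m, (\<pi>, f, ((K1, K2), (b, t)))))"
    and VW: "V = V1 \<union> W" "V1 \<inter> W = {}" and m: "m \<in> str (deriv C) V1"
    and part: "partition_on W \<pi>" and f: "f \<in> (\<Pi>\<^sub>E B\<in>\<pi>. str C B)"
    and K: "blk ` \<pi> = K1 \<union> K2" "K1 \<inter> K2 = {}"
    and b: "b \<in> str (deriv B) K1" and t: "t \<in> str (sp_subst (deriv A) B) K2"
    by (elim str_prod_subst_prodE)
  have fin: "finite V1" "finite W" and W: "W \<subseteq> V" and star: "star V \<notin> V1 \<union> W"
    using V VW(1) star_notin[OF V] by auto
  have "?lhs V s = graft A (sp_subst B C) (star V) (V1 \<union> flat K1)
      (graft B C (star (V1 \<union> flat K1)) V1 m (unblk ` K1, restrict f (unblk ` K1), b))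
      (subst_assoc (deriv A) (flat K2) (unblk ` K2, restrict f (unblk ` K2), t))"
    unfolding s by (rule chain_swap_prod_eq_graft[OF A V S[unfolded s]])
  also have "\<dots> = subst_assoc A (plus_star V)
      (graft (sp_subst A B) C (star V) V1 m (\<pi>, f, graft A B (star (blk ` \<pi>)) K1 b t))"
    by (rule subst_assoc_graft[OF A B C fin VW(2) star m part f K b t, symmetric])
  also have "\<dots> = subst_assoc A (plus_star V) (?rhs V s)"
    unfolding s chain_swap_subst_eq_graft[OF A B V W part f K b t] ..
  finally show "?lhs V s = (deriv_mor (subst_assoc A) \<circ>\<^sub>s ?rhs) V s"
    by (simp add: mor_comp_def deriv_mor_def)
qed

lemma bij_betw_subst_X:
  assumes V: "finite V" and t: "(\<pi>, f, a) \<in> str (sp_subst M sp_X) V"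
  shows "bij_betw (\<lambda>x. f (unblk x)) (blk ` \<pi>) V"
proof -
  have part: "partition_on V \<pi>" and f: "f \<in> (\<Pi>\<^sub>E B\<in>\<pi>. str sp_X B)"
    using t by (simp_all add: in_str_subst)
  have single: "B = {f B}" if "B \<in> \<pi>" for B
  proof -
    have "f B \<in> str sp_X B" using f that by auto
    then show ?thesis by (auto simp: sp_X_def card_1_singleton_iff split: if_splits)
  qed
  have "bij_betw f \<pi> V"
  proof (rule bij_betw_imageI)
    show "inj_on f \<pi>"
      by (rule inj_on_inverseI[where g = "\<lambda>v. {v}"]) (rule single[symmetric])
    have "f ` \<pi> = (\<Union>B\<in>\<pi>. {f B})"
      by auto
    also have "\<dots> = (\<Union>B\<in>\<pi>. B)"
      by (rule SUP_cong[OF refl single[symmetric]])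
    finally show "f ` \<pi> = V"
      using partition_onD1[OF part] by simp
  qed
  then show ?thesis
    using bij_betw_trans[OF bij_betw_unblk[OF finite_partition_on(2)[OF part V]]]
    by (simp add: comp_def)
qed

lemma chain_swap_lunit:
  assumes A: "is_species A"
  shows "mor_eq (sp_prod sp_one (sp_subst (deriv A) sp_X))
    (deriv_mor (subst_runit A) \<circ>\<^sub>s chain_swap A sp_X \<circ>\<^sub>s prod_mor one_deriv_X mor_id)
    (subst_runit (deriv A) \<circ>\<^sub>s prod_lunit)" (is "mor_eq ?S ?lhs ?rhs")
  unfolding mor_eq_def
proof (intro allI impI ballI)
  fix V :: "'a label set" and s
  assume V: "finite V" and s: "s \<in> str ?S V"
  then obtain z t where seq: "s = (({}, V), (z, t))" and t: "t \<in> str (sp_subst (deriv A) sp_X) V"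
    by (auto elim!: str_prodE simp: sp_one_def split: if_splits)
  obtain \<pi> f a where teq: "t = (\<pi>, f, a)" and part: "partition_on V \<pi>"
    and a: "a \<in> str (deriv A) (blk ` \<pi>)"
    using t by (elim str_substE)
  let ?s = "star V"
  note fin = finite_partition_on[OF part V]
  note bij = bij_betw_subst_X[OF V t[unfolded teq]]
  have star: "?s \<notin> V" "{?s} \<notin> \<pi>" "blk {?s} \<notin> blk ` \<pi>"
    using star_notin[OF V] insert_notin_partition[OF part, of ?s "{}"]
      blk_insert_notin_partition[OF part V, of "{}" ?s] by simp_all
  have "?lhs V s =
      subst_runit A (plus_star V) (graft A sp_X ?s {} (star {}) t)"
    using chain_swap_eq_graft[OF V subset_refl t]
    by (simp add: seq mor_comp_def prod_mor_def mor_id_def deriv_mor_def one_deriv_X_def)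
  also have "graft A sp_X ?s {} (star {}) t =
      (insert {?s} \<pi>, f({?s} := ?s), repoint A (blk ` \<pi>) (blk {?s}) a)"
    by (simp add: graft_def teq repoint_def sp_X_def)
  also have "subst_runit A (plus_star V) \<dots> =
      tr A (insert (blk {?s}) (blk ` \<pi>)) (\<lambda>x. (f({?s} := ?s)) (unblk x))
        (repoint A (blk ` \<pi>) (blk {?s}) a)"
    by (simp add: subst_runit_def)
  also have "\<dots> = repoint A V ?s (tr (deriv A) (blk ` \<pi>) (\<lambda>x. f (unblk x)) a)"
    using fin star unblk_in_partition[OF part V] by (intro tr_repoint[OF A _ a bij]) auto
  also have "\<dots> = tr (deriv A) (blk ` \<pi>) (\<lambda>x. f (unblk x)) a"
    using fin(1) a by (intro repoint_star[OF A V] tr_in[OF is_species_deriv[OF A] _ bij]) simp_all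
  also have "\<dots> = ?rhs V s"
    by (simp add: seq teq mor_comp_def prod_lunit_def subst_runit_def)
  finally show "?lhs V s = ?rhs V s" .
qed

lemma chain_swap_runit:
  assumes C: "is_species C"
  shows "mor_eq (sp_prod (deriv C) (sp_subst sp_one C))
    (deriv_mor subst_lunit \<circ>\<^sub>s chain_swap sp_X C \<circ>\<^sub>s prod_mor mor_id (subst_mor one_deriv_X mor_id))
    (prod_runit \<circ>\<^sub>s prod_mor mor_id subst_one)" (is "mor_eq ?S ?lhs ?rhs")
  unfolding mor_eq_def
proof (intro allI impI ballI)
  fix V :: "'a label set" and s
  assume V: "finite V" and s: "s \<in> str ?S V"
  then obtain p z where seq: "s = ((V, {}), (p, ({}, \<lambda>_. undefined, z)))"
    and p: "p \<in> str (deriv C) V"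
    by (auto elim!: str_prodE str_substE simp: sp_one_def partition_on_empty partition_on_def
        split: if_splits)
  let ?t = "({}, \<lambda>_. undefined, star {})"
  have t: "?t \<in> str (sp_subst (deriv sp_X) C) {}"
    by (simp add: in_str_subst partition_on_empty str_deriv plus_star_def sp_X_def)
  have "?lhs V s =
      subst_lunit (plus_star V) (graft sp_X C (star V) V p ?t)"
    using chain_swap_eq_graft[OF V empty_subsetI t]
    by (simp add: seq mor_comp_def prod_mor_def subst_mor_def mor_id_def deriv_mor_def
        one_deriv_X_def restrict_def)
  also have "\<dots> = repoint C V (star V) p"
    by (simp add: graft_def subst_lunit_def plus_star_def)
  also have "\<dots> = p"
    by (rule repoint_star[OF C V p])
  also have "\<dots> = ?rhs V s"
    by (simp add: seq mor_comp_def prod_runit_def prod_mor_def mor_id_def)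
  finally show "?lhs V s = ?rhs V s" .
qed


subsection \<open>The derivative of an operad\<close>

context
  fixes P :: "('a, 's) species"
    and \<eta> :: "('a, ('a, 's, 's) subst_str, 's) mor"
    and e :: "('a, 'a label, 's) mor"
  assumes operad: "operad P \<eta> e"
begin

lemma operad_species: "is_species P"
  and operad_mor_prod: "is_mor (sp_subst P P) P \<eta>"
  and operad_mor_unit: "is_mor sp_X P e"
  using operad by (simp_all add: operad_def)

lemma operad_assoc:
  "mor_eq (sp_subst (sp_subst P P) P)
    (\<eta> \<circ>\<^sub>s subst_mor mor_id \<eta> \<circ>\<^sub>s subst_assoc P) (\<eta> \<circ>\<^sub>s subst_mor \<eta> mor_id)"
  and operad_lunit: "mor_eq (sp_subst sp_X P) (\<eta> \<circ>\<^sub>s subst_mor e mor_id) subst_lunit"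
  and operad_runit: "mor_eq (sp_subst P sp_X) (\<eta> \<circ>\<^sub>s subst_mor mor_id e) (subst_runit P)"
  using operad by (simp_all add: operad_def)

abbreviation deriv_prod :: "('a, ('a, 's, ('a, 's, 's) subst_str) prod_str, 's) mor" where
  "deriv_prod \<equiv> deriv_mor \<eta> \<circ>\<^sub>s chain_swap P P"

abbreviation deriv_unit :: "('a, 'a label set, 's) mor" where
  "deriv_unit \<equiv> deriv_mor e \<circ>\<^sub>s one_deriv_X"

lemma is_mor_deriv_prod: "is_mor (sp_prod (deriv P) (sp_subst (deriv P) P)) (deriv P) deriv_prod"
  by (rule is_mor_comp[OF is_mor_deriv_mor[OF operad_mor_prod]
        is_mor_chain_swap[OF operad_species operad_species]])

lemma is_mor_deriv_unit: "is_mor sp_one (deriv P) deriv_unit"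
  by (rule is_mor_comp[OF is_mor_deriv_mor[OF operad_mor_unit] is_mor_one_deriv_X])

lemma deriv_prod_assoc:
  "mor_eq (sp_prod (deriv P) (sp_subst (sp_prod (deriv P) (sp_subst (deriv P) P)) P))
    (deriv_prod \<circ>\<^sub>s prod_mor deriv_prod (subst_mor mor_id \<eta>) \<circ>\<^sub>s prod_subst_assoc (deriv P))
    (deriv_prod \<circ>\<^sub>s prod_mor mor_id (subst_mor deriv_prod mor_id))" (is "mor_eq ?S ?lhs ?rhs")
proof -
  let ?\<chi> = "chain_swap P P" and ?\<alpha> = "prod_subst_assoc (deriv P)"
    and ?\<eta>' = "deriv_mor \<eta>" and ?PP = "sp_subst P P"
  note species_PP = is_species_subst[OF operad_species operad_species]
    and maps_chain = maps_str_chain_swap[OF operad_species operad_species]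
    and coherence = chain_swap_assoc[OF operad_species operad_species operad_species]
    and natural_inner = chain_swap_natural_inner[OF operad_mor_prod, of P]
    and natural_outer = mor_eq_sym[OF chain_swap_natural_outer[OF operad_mor_prod, of P]]
  have maps_left: "maps_str ?S (sp_prod (deriv ?PP) (sp_subst (deriv P) ?PP))
      (prod_mor ?\<chi> mor_id \<circ>\<^sub>s ?\<alpha>)"
    by (rule maps_str_comp[OF maps_str_prod_mor[OF maps_chain maps_str_id]
          maps_str_prod_subst_assoc[OF is_species_deriv[OF operad_species]]])
  have maps_right: "maps_str ?S (sp_prod (deriv P) (sp_subst (deriv ?PP) P))
      (prod_mor mor_id (subst_mor ?\<chi> mor_id))"
    by (intro maps_str_prod_mor maps_str_subst_mor maps_chain maps_str_id)
  have lhs: "?lhs = ?\<eta>' \<circ>\<^sub>s ?\<chi> \<circ>\<^sub>s (prod_mor ?\<eta>' (subst_mor mor_id \<eta>) \<circ>\<^sub>s prod_mor ?\<chi> mor_id) \<circ>\<^sub>s ?\<alpha>"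
    by (simp add: prod_mor_comp)
  have rhs: "?rhs = ?\<eta>' \<circ>\<^sub>s ?\<chi>
      \<circ>\<^sub>s (prod_mor mor_id (subst_mor ?\<eta>' mor_id) \<circ>\<^sub>s prod_mor mor_id (subst_mor ?\<chi> mor_id))"
    by (simp add: prod_mor_comp subst_mor_comp)
  have "mor_eq ?S ?lhs
      (?\<eta>' \<circ>\<^sub>s deriv_mor (subst_mor mor_id \<eta>) \<circ>\<^sub>s chain_swap P ?PP \<circ>\<^sub>s prod_mor ?\<chi> mor_id \<circ>\<^sub>s ?\<alpha>)"
    unfolding lhs using mor_eq_comp_left[OF mor_eq_comp_right[OF natural_inner maps_left], of ?\<eta>']
    by (simp add: mor_comp_assoc)
  also have "mor_eq ?S \<dots> (?\<eta>' \<circ>\<^sub>s deriv_mor (subst_mor mor_id \<eta>) \<circ>\<^sub>s deriv_mor (subst_assoc P)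
      \<circ>\<^sub>s chain_swap ?PP P \<circ>\<^sub>s prod_mor mor_id (subst_mor ?\<chi> mor_id))"
    using mor_eq_comp_left[OF coherence, of "?\<eta>' \<circ>\<^sub>s deriv_mor (subst_mor mor_id \<eta>)"]
    by (simp add: mor_comp_assoc)
  also have "mor_eq ?S \<dots> (?\<eta>' \<circ>\<^sub>s deriv_mor (subst_mor \<eta> mor_id)
      \<circ>\<^sub>s chain_swap ?PP P \<circ>\<^sub>s prod_mor mor_id (subst_mor ?\<chi> mor_id))"
    using mor_eq_comp_right[OF mor_eq_deriv_mor[OF operad_assoc]
        maps_str_comp[OF maps_str_chain_swap[OF species_PP operad_species] maps_right]]
    by (simp add: mor_comp_assoc deriv_mor_comp)
  also have "mor_eq ?S \<dots> ?rhs"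
    unfolding rhs using mor_eq_comp_left[OF mor_eq_comp_right[OF natural_outer maps_right], of ?\<eta>']
    by (simp add: mor_comp_assoc)
  finally show ?thesis .
qed

lemma deriv_prod_lunit:
  "mor_eq (sp_prod sp_one (sp_subst (deriv P) sp_X))
    (deriv_prod \<circ>\<^sub>s prod_mor deriv_unit (subst_mor mor_id e)) (subst_runit (deriv P) \<circ>\<^sub>s prod_lunit)"
  (is "mor_eq ?S ?lhs _")
proof -
  let ?j = "prod_mor one_deriv_X mor_id"
  have maps_j: "maps_str ?S (sp_prod (deriv sp_X) (sp_subst (deriv P) sp_X)) ?j"
    by (intro maps_str_prod_mor is_mor_maps_str[OF is_mor_one_deriv_X] maps_str_id)
  note natural = chain_swap_natural_inner[OF operad_mor_unit, of P]
  have lhs: "?lhs = deriv_prod \<circ>\<^sub>s (prod_mor (deriv_mor e) (subst_mor mor_id e) \<circ>\<^sub>s ?j)"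
    by (simp add: prod_mor_comp)
  have "mor_eq ?S ?lhs
      (deriv_mor \<eta> \<circ>\<^sub>s deriv_mor (subst_mor mor_id e) \<circ>\<^sub>s chain_swap P sp_X \<circ>\<^sub>s ?j)"
    unfolding lhs using mor_eq_comp_left[OF mor_eq_comp_right[OF natural maps_j], of "deriv_mor \<eta>"]
    by (simp add: mor_comp_assoc)
  also have "mor_eq ?S \<dots> (deriv_mor (subst_runit P) \<circ>\<^sub>s chain_swap P sp_X \<circ>\<^sub>s ?j)"
    using mor_eq_comp_right[OF mor_eq_deriv_mor[OF operad_runit]
        maps_str_comp[OF maps_str_chain_swap[OF operad_species is_species_X] maps_j]]
    by (simp add: mor_comp_assoc deriv_mor_comp)
  also have "mor_eq ?S \<dots> (subst_runit (deriv P) \<circ>\<^sub>s prod_lunit)"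
    by (rule chain_swap_lunit[OF operad_species])
  finally show ?thesis .
qed

lemma deriv_prod_runit:
  "mor_eq (sp_prod (deriv P) (sp_subst sp_one P))
    (deriv_prod \<circ>\<^sub>s prod_mor mor_id (subst_mor deriv_unit mor_id))
    (prod_runit \<circ>\<^sub>s prod_mor mor_id subst_one)" (is "mor_eq ?S ?lhs _")
proof -
  let ?j = "prod_mor mor_id (subst_mor one_deriv_X mor_id)"
  have maps_j: "maps_str ?S (sp_prod (deriv P) (sp_subst (deriv sp_X) P)) ?j"
    by (intro maps_str_prod_mor maps_str_subst_mor maps_str_id
        is_mor_maps_str[OF is_mor_one_deriv_X])
  note natural = chain_swap_natural_outer[OF operad_mor_unit, of P]
  have lhs: "?lhs = deriv_prod \<circ>\<^sub>s (prod_mor mor_id (subst_mor (deriv_mor e) mor_id) \<circ>\<^sub>s ?j)"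
    by (simp add: prod_mor_comp subst_mor_comp)
  have "mor_eq ?S ?lhs
      (deriv_mor \<eta> \<circ>\<^sub>s deriv_mor (subst_mor e mor_id) \<circ>\<^sub>s chain_swap sp_X P \<circ>\<^sub>s ?j)"
    unfolding lhs using mor_eq_comp_left[OF mor_eq_comp_right[OF natural maps_j], of "deriv_mor \<eta>"]
    by (simp add: mor_comp_assoc)
  also have "mor_eq ?S \<dots> (deriv_mor subst_lunit \<circ>\<^sub>s chain_swap sp_X P \<circ>\<^sub>s ?j)"
    using mor_eq_comp_right[OF mor_eq_deriv_mor[OF operad_lunit]
        maps_str_comp[OF maps_str_chain_swap[OF is_species_X operad_species] maps_j]]
    by (simp add: mor_comp_assoc deriv_mor_comp)
  also have "mor_eq ?S \<dots> (prod_runit \<circ>\<^sub>s prod_mor mor_id subst_one)"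
    by (rule chain_swap_runit[OF operad_species])
  finally show ?thesis .
qed

end

theorem theorem6p2:
  fixes P :: "('a, 's) species"
    and \<eta> :: "('a, ('a, 's, 's) subst_str, 's) mor"
    and e :: "('a, 'a label, 's) mor"
  assumes "operad P \<eta> e"
  shows "monop (deriv P, P)
           (deriv_mor \<eta> \<circ>\<^sub>s chain_rule P P \<circ>\<^sub>s prod_swap, \<eta>)
           (deriv_mor e \<circ>\<^sub>s one_deriv_X, e)"
proof -
  have "deriv_mor \<eta> \<circ>\<^sub>s chain_rule P P \<circ>\<^sub>s prod_swap = deriv_mor \<eta> \<circ>\<^sub>s chain_swap P P"
    by (simp add: chain_swap_def mor_comp_assoc)
  moreover have "is_riordan_obj (deriv P, P)"
    using assms is_species_deriv[OF operad_species[OF assms]] by (simp add: operad_def)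
  moreover note is_mor_deriv_prod[OF assms] is_mor_deriv_unit[OF assms]
    deriv_prod_assoc[OF assms, unfolded prod_subst_assoc_def]
    deriv_prod_lunit[OF assms] deriv_prod_runit[OF assms]
  ultimately show ?thesis
    using assms
    by (simp add: monop_def operad_def riordan_id_def riordan_unit_def riordan_runit_def)
qed

end
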